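(* Let $\mathcal{B}_x$ and $\mathcal{B}_y$ be unconditional bases of quasi-Banach spaces $X$ and $Y$ respectively. Suppose that for some integer $s\ge 2$ the $s$-fold products $\mathcal{B}_x^s$ and $\mathcal{B}_y^s$ are permutatively equivalent. Then $\mathcal{B}_x$ and $\mathcal{B}_y$ are permutatively equivalent.
   Context: Spaces are over $\mathbb{F}=\mathbb{R}$ or $\mathbb{C}$. A countable family $\mathcal{B}=(x_n)_{n\in\mathcal{N}}$ in a quasi-Banach space $X$ is an unconditional basic sequence if for every $f$ in its closed linear span $[x_n\colon n\in\mathcal{N}]$ there is a unique scalar family $(a_n)_{n\in\mathcal{N}}$ such that $\sum_{n} a_n x_n$ converges unconditionally to $f$; it is an unconditional basis of $X$ if moreover its closed linear span is $X$. Families $(x_n)_{n\in\mathcal{N}}$ in $X$ and $(u_n)_{n\in\mathcal{N}}$ in $Y$ are equivalent if there is a linear isomorphic embedding $T$ of the closed linear span of $(x_n)_{n\in\mathcal N}$ into $Y$ with $T(x_n)=u_n$ for all $n$. Families $(x_n)_{n\in\mathcal{N}}$ and $(y_m)_{m\in\mathcal{M}}$ are permutatively equivalent if there is a bijection $\pi\colon\mathcal{N}\to\mathcal{M}$ such that $(x_n)_{n\in\mathcal{N}}$ and $(y_{\pi(n)})_{n\in\mathcal{N}}$ are equivalent. For $s\in\mathbb{N}$, $X^s$ is the Cartesian product of $s$ copies of $X$ with quasi-norm $\|(f_i)_{i=1}^s\|=\max_i\|f_i\|$. If $\mathcal{B}=(x_n)_{n\in\mathcal{N}}$ is an unconditional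 basis of $X$, its $s$-fold product $\mathcal{B}^s=(x_{i,n})_{(i,n)\in\{1,\dots,s\}\times\mathcal{N}}$ is the unconditional basis of $X^s$ in which $x_{i,n}$ has $x_n$ in the $i$-th coordinate and $0$ in the others. *)

theory Defs
  imports
    Complex_Main
    "HOL-Library.Countable_Set"
    "HOL-Library.FuncSet"
    "HOL-Library.Function_Algebras"
begin

(* A space is a linear subspace (qcarrier) of an ambient vector space 'a. Keeping a carrier set,
   instead of taking the whole type, lets the power X^s be formed for a variable s :: nat.

   The scalar type ranges over the class {real_normed_field, banach}. Up to isometric isomorphism
   its members are exactly the real and the complex field (Gelfand-Mazur), so quantifying over it
   is the convention "F = R or C". *)

record ('k, 'a) qspace =
  qcarrier :: "'a set"
  qscale :: "'k \<Rightarrow> 'a \<Rightarrow> 'a"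
  qnorm :: "'a \<Rightarrow> real"

definition quasi_normed ::
    "('k::{real_normed_field,banach}, 'a::ab_group_add) qspace \<Rightarrow> bool" where
  "quasi_normed X \<longleftrightarrow>
     vector_space (qscale X) \<and>
     module.subspace (qscale X) (qcarrier X) \<and>
     (\<forall>f\<in>qcarrier X. 0 \<le> qnorm X f \<and> (qnorm X f = 0 \<longleftrightarrow> f = 0)) \<and>
     (\<forall>c. \<forall>f\<in>qcarrier X. qnorm X (qscale X c f) = norm c * qnorm X f) \<and>
     (\<exists>\<kappa>. \<forall>f\<in>qcarrier X. \<forall>g\<in>qcarrier X. qnorm X (f + g) \<le> \<kappa> * (qnorm X f + qnorm X g))"

definition quasi_banach ::
    "('k::{real_normed_field,banach}, 'a::ab_group_add) qspace \<Rightarrow> bool" where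
  "quasi_banach X \<longleftrightarrow>
     quasi_normed X \<and>
     (\<forall>F::nat \<Rightarrow> 'a.
        (\<forall>k. F k \<in> qcarrier X) \<and>
        (\<forall>\<epsilon>>0. \<exists>K. \<forall>j\<ge>K. \<forall>k\<ge>K. qnorm X (F j - F k) < \<epsilon>) \<longrightarrow>
        (\<exists>f\<in>qcarrier X. (\<lambda>k. qnorm X (F k - f)) \<longlonglongrightarrow> 0))"

(* The sets {g. qnorm X (f - g) < e}, e > 0, need not be open, but they form a neighbourhood base
   at f of the quasi-norm topology, so this is the topological closure of the span in X. *)
definition closed_span ::
    "('k::{real_normed_field,banach}, 'a::ab_group_add) qspace \<Rightarrow> 'i set \<Rightarrow> ('i \<Rightarrow> 'a) \<Rightarrow> 'a set" where
  "closed_span X N x =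
     {f \<in> qcarrier X. \<forall>\<epsilon>>0. \<exists>g\<in>module.span (qscale X) (x ` N). qnorm X (f - g) < \<epsilon>}"

(* Unconditional convergence to f is convergence of the net of finite partial sums, i.e. has_sum
   with the quasi-norm topology in place of a type-class topology. *)
definition unconditionally_sums ::
    "('k, 'a::ab_group_add) qspace \<Rightarrow> 'i set \<Rightarrow> ('i \<Rightarrow> 'a) \<Rightarrow> 'a \<Rightarrow> bool" where
  "unconditionally_sums X N u f \<longleftrightarrow>
     ((\<lambda>A. qnorm X ((\<Sum>n\<in>A. u n) - f)) \<longlongrightarrow> 0) (finite_subsets_at_top N)"

(* A scalar family indexed by N is a function in extensional N, so that the unique existence
   only concerns its values on N. *)
definition unconditional_basic_sequence ::
    "('k::{real_normed_field,banach}, 'a::ab_group_add) qspace \<Rightarrow> 'i set \<Rightarrow> ('i \<Rightarrow> 'a) \<Rightarrow> bool" where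
  "unconditional_basic_sequence X N x \<longleftrightarrow>
     countable N \<and>
     (\<forall>n\<in>N. x n \<in> qcarrier X) \<and>
     (\<forall>f\<in>closed_span X N x.
        \<exists>!a. a \<in> extensional N \<and> unconditionally_sums X N (\<lambda>n. qscale X (a n) (x n)) f)"

definition unconditional_basis ::
    "('k::{real_normed_field,banach}, 'a::ab_group_add) qspace \<Rightarrow> 'i set \<Rightarrow> ('i \<Rightarrow> 'a) \<Rightarrow> bool" where
  "unconditional_basis X N x \<longleftrightarrow>
     unconditional_basic_sequence X N x \<and> closed_span X N x = qcarrier X"

(* T is a linear map from the linear subspace S of X into Y, bounded, and (by the last clause)
   injective with bounded inverse on its range. Values of T outside S are irrelevant. *)
definition isomorphic_embedding ::
    "('k::{real_normed_field,banach}, 'a::ab_group_add) qspace \<Rightarrow> 'a set \<Rightarrow>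
     ('k, 'b::ab_group_add) qspace \<Rightarrow> ('a \<Rightarrow> 'b) \<Rightarrow> bool" where
  "isomorphic_embedding X S Y T \<longleftrightarrow>
     (\<forall>f\<in>S. T f \<in> qcarrier Y) \<and>
     (\<forall>f\<in>S. \<forall>g\<in>S. T (f + g) = T f + T g) \<and>
     (\<forall>c. \<forall>f\<in>S. T (qscale X c f) = qscale Y c (T f)) \<and>
     (\<exists>C. \<forall>f\<in>S. qnorm Y (T f) \<le> C * qnorm X f) \<and>
     (\<exists>C. \<forall>f\<in>S. qnorm X f \<le> C * qnorm Y (T f))"

definition equivalent_families ::
    "('k::{real_normed_field,banach}, 'a::ab_group_add) qspace \<Rightarrow>
     ('k, 'b::ab_group_add) qspace \<Rightarrow> 'i set \<Rightarrow> ('i \<Rightarrow> 'a) \<Rightarrow> ('i \<Rightarrow> 'b) \<Rightarrow> bool" where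
  "equivalent_families X Y N x u \<longleftrightarrow>
     (\<exists>T. isomorphic_embedding X (closed_span X N x) Y T \<and> (\<forall>n\<in>N. T (x n) = u n))"

definition permutatively_equivalent ::
    "('k::{real_normed_field,banach}, 'a::ab_group_add) qspace \<Rightarrow> 'i set \<Rightarrow> ('i \<Rightarrow> 'a) \<Rightarrow>
     ('k, 'b::ab_group_add) qspace \<Rightarrow> 'j set \<Rightarrow> ('j \<Rightarrow> 'b) \<Rightarrow> bool" where
  "permutatively_equivalent X N x Y M y \<longleftrightarrow>
     (\<exists>\<pi>. bij_betw \<pi> N M \<and> equivalent_families X Y N x (\<lambda>n. y (\<pi> n)))"

(* s-tuples are functions on nat that vanish off {1..s}; addition is pointwise
   (Function_Algebras). Max makes sense for s > 0 only. *)
definition qpower ::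
    "nat \<Rightarrow> ('k, 'a::ab_group_add) qspace \<Rightarrow> ('k, nat \<Rightarrow> 'a) qspace" where
  "qpower s X =
     \<lparr> qcarrier = {f. (\<forall>i\<in>{1..s}. f i \<in> qcarrier X) \<and> (\<forall>i. i \<notin> {1..s} \<longrightarrow> f i = 0)},
       qscale = (\<lambda>c f i. qscale X c (f i)),
       qnorm = (\<lambda>f. Max ((\<lambda>i. qnorm X (f i)) ` {1..s})) \<rparr>"

(* The s-fold product of (x n), n in N, is this family restricted to the index set {1..s} \<times> N. *)
definition product_family :: "('i \<Rightarrow> 'a::zero) \<Rightarrow> nat \<times> 'i \<Rightarrow> nat \<Rightarrow> 'a" where
  "product_family x = (\<lambda>(i, n) j. if j = i then x n else 0)"

end

theory Submission imports Defs begin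

text \<open>
  An equivalence between the \<open>s\<close>-fold products identifies \<open>{1..s} \<times> N\<close> with \<open>{1..s} \<times> M\<close>
  and thereby defines an \<open>s\<close>-regular bipartite multigraph between \<open>N\<close> and \<open>M\<close>. By Hall's
  marriage theorem in both directions, combined by the Schroeder--Bernstein construction, it has a
  perfect matching \<open>\<sigma>\<close>, so that \<open>x\<^bsub>i(n),n\<^esub>\<close> corresponds to \<open>y\<^bsub>j(n),\<sigma>(n)\<^esub>\<close> for suitable
  \<open>i(n)\<close> and \<open>j(n)\<close>. Since the coordinate projections of an unconditional basis onto arbitrary
  index sets are bounded, distributing the basis over the coordinates by \<open>x\<^bsub>n\<^esub> \<mapsto> x\<^bsub>i(n),n\<^esub>\<close> is an
  embedding inverted by summing the coordinates, and likewise for \<open>y\<close>.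
\<close>

section \<open>Quasi-Banach spaces\<close>

text \<open>The obstacle is that no bound is given. An unconditional basis is defined by existence
  and uniqueness of unconditional expansions alone, so at the outset neither the continuity of the
  coefficients nor a uniform bound for the partial sums is available; a bound has to be extracted
  from completeness by a Baire category argument. Quasi-norms make this delicate: they need not be
  continuous, and adding up k terms with the quasi-triangle inequality may cost a factor \<kappa> to
  the power k. Sums of unbounded length are therefore estimated term by term only when the bounds on
  the terms shrink by a factor 2\<kappa> per step, and each passage to a limit costs one more
  \<kappa>.

  Projections enter because the position i(n) varies with n: no single coordinate of the power need
  receive the whole basis. There are only s positions, so the basis splits into s pieces on which
  i(n) is constant. The matching gives no control over these pieces, hence projections onto
  arbitrary index sets are required.\<close>

locale quasi_normed_space =
  fixes X :: "('k::{real_normed_field,banach}, 'a::ab_group_add) qspace" and \<kappa> :: real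
  assumes vector_space_scale: "vector_space (qscale X)"
    and subspace_carrier: "module.subspace (qscale X) (qcarrier X)"
    and norm_nonneg: "f \<in> qcarrier X \<Longrightarrow> 0 \<le> qnorm X f"
    and norm_eq_0: "f \<in> qcarrier X \<Longrightarrow> qnorm X f = 0 \<longleftrightarrow> f = 0"
    and norm_scale: "f \<in> qcarrier X \<Longrightarrow> qnorm X (qscale X c f) = norm c * qnorm X f"
    and norm_triangle: "f \<in> qcarrier X \<Longrightarrow> g \<in> qcarrier X \<Longrightarrow>
          qnorm X (f + g) \<le> \<kappa> * (qnorm X f + qnorm X g)"
    and kappa_ge_1: "1 \<le> \<kappa>"

text \<open>Taking g = 0 in the quasi-triangle inequality shows that only the zero space admits a
  constant below 1; passing to \<open>max \<kappa> 1\<close> treats all cases alike and is harmless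
  because norms are nonnegative.\<close>

lemma quasi_normed_iff: "quasi_normed X \<longleftrightarrow> (\<exists>\<kappa>. quasi_normed_space X \<kappa>)"
proof
  assume q: "quasi_normed X"
  then obtain \<kappa> where \<kappa>: "\<forall>f\<in>qcarrier X. \<forall>g\<in>qcarrier X. qnorm X (f + g) \<le> \<kappa> * (qnorm X f + qnorm X g)"
    unfolding quasi_normed_def by blast
  have tri: "qnorm X (f + g) \<le> max \<kappa> 1 * (qnorm X f + qnorm X g)"
    if fg: "f \<in> qcarrier X" "g \<in> qcarrier X" for f g
  proof -
    have "qnorm X f + qnorm X g \<ge> 0" using q fg unfolding quasi_normed_def by force
    then have "\<kappa> * (qnorm X f + qnorm X g) \<le> max \<kappa> 1 * (qnorm X f + qnorm X g)"
      by (intro mult_right_mono) auto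
    then show ?thesis using \<kappa> fg by force
  qed
  have "quasi_normed_space X (max \<kappa> 1)"
    using q tri unfolding quasi_normed_def quasi_normed_space_def by simp
  then show "\<exists>\<kappa>. quasi_normed_space X \<kappa>" ..
next
  show "\<exists>\<kappa>. quasi_normed_space X \<kappa> \<Longrightarrow> quasi_normed X"
    unfolding quasi_normed_def quasi_normed_space_def by blast
qed

context quasi_normed_space
begin

sublocale vector_space "qscale X"
  by (rule vector_space_scale)

lemmas zero_in = subspace_0[OF subspace_carrier]
lemmas add_in = subspace_add[OF subspace_carrier]
lemmas diff_in = subspace_diff[OF subspace_carrier]
lemmas neg_in = subspace_neg[OF subspace_carrier]
lemmas scale_in = subspace_scale[OF subspace_carrier]
lemmas sum_in = subspace_sum[OF subspace_carrier]
lemmas carrier_intros [intro] = zero_in add_in diff_in neg_in scale_in sum_in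

lemma norm_zero [simp]: "qnorm X 0 = 0"
  using norm_eq_0 zero_in by blast

lemma norm_uminus: "f \<in> qcarrier X \<Longrightarrow> qnorm X (- f) = qnorm X f"
  using norm_scale[of f "-1"] by simp

lemma norm_minus_commute:
  assumes "f \<in> qcarrier X" "g \<in> qcarrier X"
  shows "qnorm X (f - g) = qnorm X (g - f)"
  using norm_uminus[OF diff_in[OF assms]] by simp

lemma norm_triangle_le:
  assumes "f \<in> qcarrier X" "g \<in> qcarrier X" "qnorm X f \<le> a" "qnorm X g \<le> b"
  shows "qnorm X (f + g) \<le> \<kappa> * (a + b)"
proof -
  have "qnorm X (f + g) \<le> \<kappa> * (qnorm X f + qnorm X g)"
    using assms norm_triangle by blast
  also have "\<dots> \<le> \<kappa> * (a + b)"
    using assms kappa_ge_1 by (intro mult_left_mono) auto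
  finally show ?thesis .
qed

lemma norm_triangle_diff_le:
  assumes "f \<in> qcarrier X" "g \<in> qcarrier X" "qnorm X f \<le> a" "qnorm X g \<le> b"
  shows "qnorm X (f - g) \<le> \<kappa> * (a + b)"
  using norm_triangle_le[of f "- g" a b] assms norm_uminus by auto

lemma norm_triangle_via:
  assumes "f \<in> qcarrier X" "g \<in> qcarrier X" "h \<in> qcarrier X"
    and "qnorm X (f - h) \<le> a" "qnorm X (h - g) \<le> b"
  shows "qnorm X (f - g) \<le> \<kappa> * (a + b)"
  using norm_triangle_le[of "f - h" "h - g" a b] assms by auto

end

text \<open>Peeling off the first term, the rest is bounded by
  \<open>2 * \<kappa> * c (Suc m)\<close>, which the decay makes at most \<open>c m\<close>; so the
  total is at most \<open>\<kappa> * (c m + c m)\<close> whatever the number of terms. The bound is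
  a relation \<open>R\<close> so that the same induction serves both the norm of the space and the
  second quasi-norm of the closed graph argument.\<close>

lemma quasi_subadditive_sum:
  fixes R :: "real \<Rightarrow> 'a::ab_group_add \<Rightarrow> bool"
  assumes zero: "R 0 0"
    and mono: "\<And>c d f. R c f \<Longrightarrow> c \<le> d \<Longrightarrow> R d f"
    and add: "\<And>c d f g. R c f \<Longrightarrow> R d g \<Longrightarrow> R (\<kappa> * (c + d)) (f + g)"
    and \<kappa>: "1 \<le> \<kappa>"
    and nonneg: "\<And>j. 0 \<le> c j"
    and decay: "\<And>j. 2 * \<kappa> * c (Suc j) \<le> c j"
    and w: "\<And>j. R (c j) (w j)"
  shows "R (2 * \<kappa> * c m) (\<Sum>j=m..<m+k. w j)"
proof (induction k arbitrary: m)
  case 0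
  then show ?case using zero mono nonneg[of m] \<kappa> by simp
next
  case (Suc k)
  have "R (\<kappa> * (c m + 2 * \<kappa> * c (Suc m))) (w m + (\<Sum>j=Suc m..<Suc m+k. w j))"
    by (intro add w Suc.IH)
  moreover have "\<kappa> * (c m + 2 * \<kappa> * c (Suc m)) \<le> \<kappa> * (c m + c m)"
    using decay[of m] \<kappa> by (intro mult_left_mono) auto
  moreover have "(\<Sum>j=m..<m+Suc k. w j) = w m + (\<Sum>j=Suc m..<Suc m+k. w j)"
    by (simp add: sum.atLeast_Suc_lessThan)
  ultimately show ?case
    using mono by (metis mult.assoc mult.commute mult_2)
qed

context quasi_normed_space
begin

lemma norm_diff_telescope:
  assumes F: "\<And>j. F j \<in> qcarrier X"
    and decay: "\<And>j. 2 * \<kappa> * c (Suc j) \<le> c j"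
    and step: "\<And>j. qnorm X (F (Suc j) - F j) \<le> c j"
    and "m \<le> n"
  shows "qnorm X (F n - F m) \<le> 2 * \<kappa> * c m"
proof -
  obtain k where n: "n = m + k" using \<open>m \<le> n\<close> le_Suc_ex by blast
  let ?R = "\<lambda>c f. f \<in> qcarrier X \<and> qnorm X f \<le> c"
  have "?R (2 * \<kappa> * c m) (\<Sum>j=m..<m+k. F (Suc j) - F j)"
  proof (rule quasi_subadditive_sum[where R = ?R])
    show "0 \<le> c j" for j
      using step[of j] norm_nonneg[of "F (Suc j) - F j"] F by (meson diff_in order_trans)
  qed (use F decay step kappa_ge_1 norm_triangle_le in \<open>auto\<close>)
  then show ?thesis by (simp add: n sum_Suc_diff')
qed

text \<open>The factor \<^term>\<open>\<kappa>\<close> is there because a quasi-norm need not be continuous.\<close>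

lemma norm_limit_le:
  assumes F: "\<And>j. F j \<in> qcarrier X" and f: "f \<in> qcarrier X"
    and lim: "(\<lambda>j. qnorm X (F j - f)) \<longlonglongrightarrow> 0"
    and g: "g \<in> qcarrier X"
    and le: "\<And>j. j \<ge> m \<Longrightarrow> qnorm X (F j - g) \<le> c"
  shows "qnorm X (f - g) \<le> \<kappa> * c"
proof (rule LIMSEQ_le_const)
  show "(\<lambda>j. \<kappa> * (qnorm X (F j - f) + c)) \<longlonglongrightarrow> \<kappa> * c"
    using tendsto_mult_left[OF tendsto_add[OF lim tendsto_const[of c]], of \<kappa>] by simp
  show "\<exists>M. \<forall>j\<ge>M. qnorm X (f - g) \<le> \<kappa> * (qnorm X (F j - f) + c)"
    using norm_triangle_via[OF f g F] le F f norm_minus_commute by (metis order_refl)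
qed

end

section \<open>Completeness: Baire category and a closed graph principle\<close>

locale quasi_banach_space = quasi_normed_space +
  assumes complete: "(\<And>k. F k \<in> qcarrier X) \<Longrightarrow>
      (\<And>\<epsilon>. \<epsilon> > 0 \<Longrightarrow> \<exists>K. \<forall>j\<ge>K. \<forall>k\<ge>K. qnorm X (F j - F k) < \<epsilon>) \<Longrightarrow>
      \<exists>f\<in>qcarrier X. (\<lambda>k. qnorm X (F k - f)) \<longlonglongrightarrow> 0"
begin

text \<open>In the constant, 2\<kappa> is the price of telescoping and the further \<kappa> that of
  letting the index tend to infinity.\<close>

lemma geometric_step_convergent:
  assumes F: "\<And>j. F j \<in> qcarrier X"
    and decay: "\<And>j. 2 * \<kappa> * c (Suc j) \<le> c j"
    and step: "\<And>j. qnorm X (F (Suc j) - F j) \<le> c j"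
    and c: "c \<longlonglongrightarrow> 0"
  obtains f where "f \<in> qcarrier X" "\<And>m. qnorm X (f - F m) \<le> 2 * \<kappa>\<^sup>2 * c m"
proof -
  note tele = norm_diff_telescope[of F c, OF F decay step]
  have "\<exists>K. \<forall>j\<ge>K. \<forall>k\<ge>K. qnorm X (F j - F k) < \<epsilon>" if "\<epsilon> > 0" for \<epsilon> :: real
  proof -
    have "(\<lambda>m. 2 * \<kappa>\<^sup>2 * (c m + c m) * 2) \<longlonglongrightarrow> 2 * \<kappa>\<^sup>2 * (0 + 0) * 2"
      by (intro tendsto_intros c)
    then have "\<forall>\<^sub>F m in sequentially. 2 * \<kappa>\<^sup>2 * (c m + c m) * 2 < \<epsilon>"
      by (rule order_tendstoD) (use that in simp)
    then obtain K where K: "2 * \<kappa>\<^sup>2 * (c K + c K) * 2 < \<epsilon>"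
      by (auto simp: eventually_sequentially)
    have cK: "0 \<le> c K"
      using step[of K] norm_nonneg[of "F (Suc K) - F K"] F by (meson diff_in order_trans)
    have "qnorm X (F j - F k) < \<epsilon>" if "j \<ge> K" "k \<ge> K" for j k
    proof -
      have "qnorm X (F j - F k) \<le> \<kappa> * (2 * \<kappa> * c K + 2 * \<kappa> * c K)"
        using tele that F norm_minus_commute by (intro norm_triangle_via[of _ _ "F K"]) metis+
      also have "\<dots> = 2 * \<kappa>\<^sup>2 * (c K + c K)" by (simp add: power2_eq_square algebra_simps)
      also have "\<dots> \<le> 2 * \<kappa>\<^sup>2 * (c K + c K) * 2" using cK by simp
      finally show ?thesis using K by simp
    qed
    then show ?thesis by blast
  qed
  then obtain f where f: "f \<in> qcarrier X" "(\<lambda>k. qnorm X (F k - f)) \<longlonglongrightarrow> 0"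
    using complete[of F] F by blast
  have "qnorm X (f - F m) \<le> 2 * \<kappa>\<^sup>2 * c m" for m
    using norm_limit_le[OF F f F, of m m "2 * \<kappa> * c m"] tele[of m]
    by (simp add: power2_eq_square mult_ac)
  with f(1) show thesis using that by blast
qed

text \<open>Since balls of a quasi-norm need not be open, being dense in a ball is expressed by
  approximation. If it failed for every \<open>W k\<close>, each ball would contain a point at
  positive distance from \<open>W k\<close>; such points, chosen successively with rapidly shrinking
  radii, converge to a point outside every \<open>W k\<close>.\<close>

lemma baire_category:
  assumes cover: "qcarrier X \<subseteq> (\<Union>k::nat. W k)"
  shows "\<exists>k. \<exists>f\<in>qcarrier X. \<exists>r>0. \<forall>g\<in>qcarrier X. qnorm X (g - f) < r \<longrightarrow>
           (\<forall>\<delta>>0. \<exists>h\<in>qcarrier X \<inter> W k. qnorm X (h - g) < \<delta>)"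
    (is ?claim)
proof (rule ccontr)
  assume no_ball: "\<not> ?claim"
  define D where "D = (\<lambda>k f r. \<forall>g\<in>qcarrier X. qnorm X (g - f) < r \<longrightarrow>
      (\<forall>\<delta>>0. \<exists>h\<in>qcarrier X \<inter> W k. qnorm X (h - g) < \<delta>))"
  have "\<not> (\<exists>k. \<exists>f\<in>qcarrier X. \<exists>r>0. D k f r)"
    using no_ball unfolding D_def .
  then have not_D: "\<not> D k f r" if "f \<in> qcarrier X" "r > 0" for k f r
    using that by blast
  have hole: "\<exists>g\<in>qcarrier X. \<exists>\<delta>>0. qnorm X (g - f) < r \<and>
       (\<forall>h\<in>qcarrier X \<inter> W k. \<delta> \<le> qnorm X (h - g))"
    if "f \<in> qcarrier X" "r > 0" for k f r
    using not_D[OF that, of k] unfolding D_def by (meson not_le)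
  define P where "P = (\<lambda>p. fst p \<in> qcarrier X \<and> 0 < (snd p :: real))"
  \<comment> \<open>Pairs are (centre, radius). The middle condition is the decay needed for
    convergence; as the limit will lie within 2\<kappa>\<twosuperior> radii of each centre, the last
    one keeps it out of \<open>W n\<close>. It is pair \<open>Suc n\<close> that avoids
    \<open>W n\<close>.\<close>
  define Q where "Q = (\<lambda>n p q. qnorm X (fst q - fst p) \<le> snd p \<and> 2 * \<kappa> * snd q \<le> snd p \<and>
       (\<forall>h\<in>qcarrier X \<inter> W n. 2 * \<kappa>\<^sup>2 * snd q < qnorm X (h - fst q)))"
  have "\<exists>p. \<forall>n::nat. P (p n) \<and> Q n (p n) (p (Suc n))"
  proof (rule dependent_nat_choice)
    show "\<exists>p. P p" using zero_in by (intro exI[of _ "(0, 1)"]) (auto simp: P_def)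
    fix p :: "'b \<times> real" and n :: nat
    assume "P p"
    then obtain g \<delta> where g: "g \<in> qcarrier X" "\<delta> > 0" "qnorm X (g - fst p) < snd p"
        "\<And>h. h \<in> qcarrier X \<inter> W n \<Longrightarrow> \<delta> \<le> qnorm X (h - g)"
      using hole[of "fst p" "snd p" n] unfolding P_def by blast
    \<comment> \<open>The first bound gives the decay by 2\<kappa>; the second gives
      2\<kappa>\<twosuperior> r at most \<delta>/2, hence strictly below the distance \<delta> to
      \<open>W n\<close>.\<close>
    define r where "r = min (snd p / (2 * \<kappa>)) (\<delta> / (4 * \<kappa>\<^sup>2))"
    have "r > 0" using \<open>P p\<close> g kappa_ge_1 by (auto simp: r_def P_def)
    have "2 * \<kappa> * r \<le> 2 * \<kappa> * (snd p / (2 * \<kappa>))"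
      using kappa_ge_1 by (intro mult_left_mono) (auto simp: r_def)
    then have r1: "2 * \<kappa> * r \<le> snd p" using kappa_ge_1 by simp
    have "2 * \<kappa>\<^sup>2 * r \<le> 2 * \<kappa>\<^sup>2 * (\<delta> / (4 * \<kappa>\<^sup>2))"
      using kappa_ge_1 by (intro mult_left_mono) (auto simp: r_def)
    also have "\<dots> = \<delta> / 2" using kappa_ge_1 by (simp add: field_simps)
    finally have r2: "2 * \<kappa>\<^sup>2 * r < \<delta>" using g(2) by simp
    show "\<exists>q. P q \<and> Q n p q"
      using g \<open>r > 0\<close> r1 r2 by (intro exI[of _ "(g, r)"]) (force simp: P_def Q_def)
  qed
  then obtain p where p: "\<And>n. P (p n)" "\<And>n. Q n (p n) (p (Suc n))" by blast
  have r_le: "snd (p n) \<le> snd (p 0) * (1/2) ^ n" for n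
  proof (induction n)
    case (Suc n)
    have "2 * snd (p (Suc n)) \<le> 2 * \<kappa> * snd (p (Suc n))"
      using p(1)[of "Suc n"] kappa_ge_1 by (simp add: P_def)
    then show ?case using p(2)[of n] Suc by (auto simp: Q_def)
  qed simp
  have "(\<lambda>n. snd (p 0) * (1/2) ^ n) \<longlonglongrightarrow> snd (p 0) * 0"
    by (intro tendsto_intros LIMSEQ_power_zero) simp
  then have lim0: "(\<lambda>n. snd (p 0) * (1/2) ^ n) \<longlonglongrightarrow> 0" by simp
  have "0 \<le> snd (p n)" for n using p(1)[of n] by (simp add: P_def)
  then have lim: "(\<lambda>n. snd (p n)) \<longlonglongrightarrow> 0"
    by (intro real_tendsto_sandwich[OF always_eventually always_eventually tendsto_const lim0])
      (use r_le in blast)+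
  have "fst (p j) \<in> qcarrier X" for j using p(1)[of j] by (simp add: P_def)
  moreover have "2 * \<kappa> * snd (p (Suc j)) \<le> snd (p j)"
    and "qnorm X (fst (p (Suc j)) - fst (p j)) \<le> snd (p j)" for j
    using p(2)[of j] by (simp_all add: Q_def)
  ultimately obtain f where f: "f \<in> qcarrier X" "\<And>m. qnorm X (f - fst (p m)) \<le> 2 * \<kappa>\<^sup>2 * snd (p m)"
    using geometric_step_convergent[OF _ _ _ lim, of "\<lambda>n. fst (p n)"] by metis
  obtain k where "f \<in> W k" using cover f(1) by blast
  then have "2 * \<kappa>\<^sup>2 * snd (p (Suc k)) < qnorm X (f - fst (p (Suc k)))"
    using p(2)[of k] f(1) unfolding Q_def by blast
  then show False using f(2)[of "Suc k"] by linarith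
qed

text \<open>A closed graph theorem in relational form: \<^term>\<open>W c f\<close> says that a second, stronger
  quasi-norm is at most \<^term>\<open>c\<close> at \<^term>\<open>f\<close>. By Baire some sublevel set of it is dense in a ball
  of \<^term>\<open>X\<close>; successive approximation then writes every element of the unit ball as a
  geometrically convergent series for both quasi-norms.\<close>

lemma stronger_norm_bounded:
  fixes W :: "real \<Rightarrow> 'b \<Rightarrow> bool"
  assumes finite_norm: "\<And>f. f \<in> qcarrier X \<Longrightarrow> \<exists>c. W c f"
    and mono: "\<And>c d f. W c f \<Longrightarrow> c \<le> d \<Longrightarrow> W d f"
    and zero: "W 0 0"
    and add: "\<And>c d f g. f \<in> qcarrier X \<Longrightarrow> g \<in> qcarrier X \<Longrightarrow> W c f \<Longrightarrow> W d g \<Longrightarrow>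
                W (\<kappa> * (c + d)) (f + g)"
    and scale: "\<And>c t f. f \<in> qcarrier X \<Longrightarrow> W c f \<Longrightarrow> W (norm t * c) (qscale X t f)"
    and closed: "\<And>u f c. (\<And>j. u j \<in> qcarrier X) \<Longrightarrow> f \<in> qcarrier X \<Longrightarrow>
        (\<lambda>j. qnorm X (u j - f)) \<longlonglongrightarrow> 0 \<Longrightarrow>
        (\<And>\<epsilon>. \<epsilon> > 0 \<Longrightarrow> \<exists>J. \<forall>i\<ge>J. \<forall>j\<ge>J. W \<epsilon> (u i - u j)) \<Longrightarrow>
        (\<And>j. W c (u j)) \<Longrightarrow> W (L * c) f"
  shows "\<exists>K\<ge>0. \<forall>f\<in>qcarrier X. W (K * qnorm X f) f"
proof -
  have W_neg: "W c (- f)" if "f \<in> qcarrier X" "W c f" for c f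
    using scale[OF that, of "-1"] by simp
  have cover: "qcarrier X \<subseteq> (\<Union>k::nat. {f. W (real k) f})"
  proof
    fix f assume "f \<in> qcarrier X"
    then obtain c where "W c f" using finite_norm by blast
    then have "W (real (nat \<lceil>c\<rceil>)) f" by (rule mono) (rule real_nat_ceiling_ge)
    then show "f \<in> (\<Union>k::nat. {f. W (real k) f})" by blast
  qed
  obtain k f0 r where f0: "f0 \<in> qcarrier X" and r: "r > 0"
    and dense0: "\<forall>g\<in>qcarrier X. qnorm X (g - f0) < r \<longrightarrow>
          (\<forall>\<delta>>0. \<exists>h\<in>qcarrier X \<inter> {f. W (real k) f}. qnorm X (h - g) < \<delta>)"
    using baire_category[OF cover] by metis
  have dense: "\<exists>h\<in>qcarrier X. W (real k) h \<and> qnorm X (h - g) < \<delta>"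
    if "g \<in> qcarrier X" "qnorm X (g - f0) < r" "\<delta> > 0" for g \<delta>
    using dense0[rule_format, OF that] by blast
  \<comment> \<open>The ball of density is moved from \<open>f0\<close> to the origin: an
    approximant of \<open>g + f0\<close> minus an approximant of \<open>f0\<close> approximates
    \<open>g\<close>, and the level grows only from k to 2\<kappa>k.\<close>
  have near_zero: "\<exists>h\<in>qcarrier X. W (2 * \<kappa> * k) h \<and> qnorm X (g - h) \<le> \<delta>"
    if g: "g \<in> qcarrier X" "qnorm X g < r" and "\<delta> > 0" for g \<delta>
  proof -
    define e where "e = \<delta> / (2 * \<kappa>)"
    have e: "e > 0" using \<open>\<delta> > 0\<close> kappa_ge_1 by (simp add: e_def)
    obtain h1 where h1: "h1 \<in> qcarrier X" "W (real k) h1" "qnorm X (h1 - (g + f0)) < e"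
      using dense[of "g + f0" e] g f0 e by auto
    obtain h2 where h2: "h2 \<in> qcarrier X" "W (real k) h2" "qnorm X (h2 - f0) < e"
      using dense[of "f0" e] f0 r e by auto
    have "W (2 * \<kappa> * k) (h1 + - h2)"
      using add[of h1 "- h2" k k] W_neg h1 h2 by (simp add: algebra_simps neg_in)
    moreover have "qnorm X ((h2 - f0) - (h1 - (g + f0))) \<le> \<kappa> * (e + e)"
      using h1 h2 f0 g by (intro norm_triangle_diff_le) auto
    then have "qnorm X (g - (h1 + - h2)) \<le> \<delta>"
      using kappa_ge_1 by (simp add: e_def algebra_simps)
    ultimately show ?thesis using h1 h2 by blast
  qed
  \<comment> \<open>The factor 2/r undoes the rescaling by t = r/(2c), which brings an element of
    norm at most c to norm at most r/2, strictly inside the ball.\<close>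
  define K where "K = 2 * \<kappa> * k * 2 / r"
  have K: "K \<ge> 0" using r kappa_ge_1 by (simp add: K_def)
  have approx: "\<exists>h\<in>qcarrier X. W (K * c) h \<and> qnorm X (g - h) \<le> \<delta>"
    if g: "g \<in> qcarrier X" "qnorm X g \<le> c" and "c > 0" "\<delta> > 0" for g c \<delta>
  proof -
    define t where "t = r / (2 * c)"
    have t: "t > 0" using r \<open>c > 0\<close> by (simp add: t_def)
    have "qnorm X (qscale X (of_real t) g) = t * qnorm X g"
      using norm_scale g t by simp
    also have "\<dots> \<le> t * c" using g t by simp
    also have "\<dots> < r" using r \<open>c > 0\<close> by (simp add: t_def)
    finally obtain h where h: "h \<in> qcarrier X" "W (2 * \<kappa> * k) h"
        "qnorm X (qscale X (of_real t) g - h) \<le> t * \<delta>"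
      using near_zero[of "qscale X (of_real t) g" "t * \<delta>"] g t \<open>\<delta> > 0\<close> by auto
    let ?h = "qscale X (of_real (1 / t)) h"
    have "W (norm (of_real (1 / t) :: 'a) * (2 * \<kappa> * k)) ?h" using scale h by blast
    moreover have "norm (of_real (1 / t) :: 'a) * (2 * \<kappa> * k) = K * c"
      using t \<open>c > 0\<close> r by (simp add: norm_divide t_def K_def)
    moreover have "qnorm X (g - ?h) = qnorm X (qscale X (of_real (1 / t)) (qscale X (of_real t) g - h))"
      using t by (simp add: scale_right_diff_distrib flip: of_real_mult)
    moreover have "\<dots> = (1 / t) * qnorm X (qscale X (of_real t) g - h)"
      using t h g by (subst norm_scale) (auto simp: norm_divide)
    moreover have "\<dots> \<le> (1 / t) * (t * \<delta>)"
      using h t by (intro mult_left_mono) auto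
    ultimately show ?thesis using h t by auto
  qed
  \<comment> \<open>The largest ratio for which \<open>quasi_subadditive_sum\<close> applies; its
    decay condition then holds with equality.\<close>
  define \<theta> where "\<theta> = 1 / (2 * \<kappa>)"
  have \<theta>: "0 < \<theta>" "\<theta> < 1" "2 * \<kappa> * \<theta> = 1" using kappa_ge_1 by (auto simp: \<theta>_def)
  have bound: "W (L * (2 * \<kappa> * (K * c))) f" if f: "f \<in> qcarrier X" "qnorm X f \<le> c" and c: "c > 0" for f c
  proof -
    \<comment> \<open>Here \<open>g n\<close> is the remainder after n corrections, and
      \<open>u n\<close> below is the sum of these corrections. Positivity of c keeps every
      tolerance \<open>c * \<theta> ^ n\<close> positive, as \<open>approx\<close> demands.\<close>
    define P where "P = (\<lambda>n g. g \<in> qcarrier X \<and> qnorm X g \<le> c * \<theta> ^ n)"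
    define Q where "Q = (\<lambda>n g g'. W (K * (c * \<theta> ^ n)) (g - g'))"
    have "\<exists>g. \<forall>n. (P n (g n) \<and> (n = 0 \<longrightarrow> g n = f)) \<and> Q n (g n) (g (Suc n))"
    proof (rule dependent_nat_choice)
      show "\<exists>g. P 0 g \<and> (0 = 0 \<longrightarrow> g = f)" using f by (auto simp: P_def)
      fix g n assume "P n g \<and> (n = 0 \<longrightarrow> g = f)"
      then obtain h where "h \<in> qcarrier X" "W (K * (c * \<theta> ^ n)) h" "qnorm X (g - h) \<le> c * \<theta> ^ Suc n"
        using approx[of g "c * \<theta> ^ n" "c * \<theta> ^ Suc n"] c \<theta> by (auto simp: P_def)
      then show "\<exists>g'. (P (Suc n) g' \<and> (Suc n = 0 \<longrightarrow> g' = f)) \<and> Q n g g'"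
        using \<open>P n g \<and> _\<close> by (intro exI[of _ "g - h"]) (auto simp: P_def Q_def)
    qed
    then obtain g where P: "\<And>n. P n (g n)" and g0: "g 0 = f" and Q: "\<And>n. Q n (g n) (g (Suc n))"
      by blast
    have g: "g n \<in> qcarrier X" "qnorm X (g n) \<le> c * \<theta> ^ n" for n
      using P by (auto simp: P_def)
    define u where "u = (\<lambda>n. f - g n)"
    have u: "u n \<in> qcarrier X" for n using f g by (auto simp: u_def)
    let ?R = "\<lambda>c f. f \<in> qcarrier X \<and> W c f"
    have tele: "W (2 * \<kappa> * (K * (c * \<theta> ^ m))) (u n - u m)" if "m \<le> n" for m n
    proof -
      obtain k where n: "n = m + k" using \<open>m \<le> n\<close> le_Suc_ex by blast
      have "?R (2 * \<kappa> * (K * (c * \<theta> ^ m))) (\<Sum>j=m..<m+k. u (Suc j) - u j)"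
      proof (rule quasi_subadditive_sum[where R = ?R and c = "\<lambda>m. K * (c * \<theta> ^ m)"])
        show "2 * \<kappa> * (K * (c * \<theta> ^ Suc j)) \<le> K * (c * \<theta> ^ j)" for j
        proof -
          have "2 * \<kappa> * (K * (c * \<theta> ^ Suc j)) = (2 * \<kappa> * \<theta>) * (K * (c * \<theta> ^ j))"
            by (simp only: power_Suc mult_ac)
          then show ?thesis by (simp only: \<theta>(3) mult_1 order_refl)
        qed
        show "u (Suc j) - u j \<in> qcarrier X \<and> W (K * (c * \<theta> ^ j)) (u (Suc j) - u j)" for j
          using Q[of j] diff_in[OF g(1)[of j] g(1)[of "Suc j"]] by (simp add: Q_def u_def)
      qed (use K c \<theta> kappa_ge_1 zero mono add in \<open>auto\<close>)
      then show ?thesis by (simp add: n sum_Suc_diff')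
    qed
    have lim0: "(\<lambda>n. d * (c * \<theta> ^ n)) \<longlonglongrightarrow> 0" for d
    proof -
      have "(\<lambda>n. d * (c * \<theta> ^ n)) \<longlonglongrightarrow> d * (c * 0)"
        by (intro tendsto_intros LIMSEQ_power_zero) (use \<theta> in auto)
      then show ?thesis by simp
    qed
    show ?thesis
    \<comment> \<open>Closedness of the second quasi-norm is assumed only along sequences that are
      Cauchy for it as well; the telescoping bound supplies this together with the uniform
      level.\<close>
    proof (rule closed[of u])
      have "qnorm X (u n - f) \<le> 1 * (c * \<theta> ^ n)" for n
        using g[of n] norm_uminus[of "g n"] by (simp add: u_def)
      then show "(\<lambda>j. qnorm X (u j - f)) \<longlonglongrightarrow> 0"
        using u f norm_nonneg
        by (intro real_tendsto_sandwich[OF always_eventually always_eventually tendsto_const lim0[of 1]])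
          blast+
      show "W (2 * \<kappa> * (K * c)) (u j)" for j
        using tele[of 0 j] by (simp add: u_def g0)
      show "\<exists>J. \<forall>i\<ge>J. \<forall>j\<ge>J. W \<epsilon> (u i - u j)" if "\<epsilon> > 0" for \<epsilon> :: real
      proof -
        have "\<forall>\<^sub>F n in sequentially. 2 * \<kappa> * K * (c * \<theta> ^ n) < \<epsilon>"
          using lim0 that by (rule order_tendstoD)
        then obtain J where J: "\<And>n. n \<ge> J \<Longrightarrow> 2 * \<kappa> * K * (c * \<theta> ^ n) < \<epsilon>"
          by (auto simp: eventually_sequentially)
        have le: "W \<epsilon> (u i - u j)" if "j \<ge> J" "j \<le> i" for i j
          using mono[OF tele[OF that(2)], of \<epsilon>] J[OF that(1)] by (simp add: mult_ac)
        have "W \<epsilon> (u i - u j)" if "i \<ge> J" "j \<ge> J" for i j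
          using le[of j i] le[of i j] W_neg[of "u j - u i" \<epsilon>] u that
          by (metis diff_in minus_diff_eq nat_le_linear)
        then show ?thesis by blast
      qed
    qed (use u f in auto)
  qed
  \<comment> \<open>The estimate \<open>bound\<close> wants a positive radius, so the zero vector is
    treated apart. The maximum with 0 makes the constant nonnegative, \<open>L\<close> having no
    prescribed sign.\<close>
  have "W (max 0 (L * (2 * \<kappa> * K)) * qnorm X f) f" if f: "f \<in> qcarrier X" for f
  proof (cases "f = 0")
    case True
    then show ?thesis using zero by simp
  next
    case False
    then have "qnorm X f > 0" using f norm_nonneg[OF f] norm_eq_0[OF f] by linarith
    then show ?thesis
      using mono[OF bound[OF f order_refl], of "max 0 (L * (2 * \<kappa> * K)) * qnorm X f"]
      by (metis max.cobounded2 mult.assoc mult_right_mono less_imp_le)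
  qed
  then show ?thesis by (intro exI[of _ "max 0 (L * (2 * \<kappa> * K))"]) auto
qed

end

section \<open>Perfect matchings of regular bipartite graphs\<close>

text \<open>Rado's argument: a minimal subrelation satisfying Hall's condition is a matching.\<close>

lemma hall_marriage:
  fixes E :: "('a \<times> 'b) set"
  assumes fin: "\<And>i. i \<in> I \<Longrightarrow> finite (E `` {i})"
    and hall: "\<And>F. finite F \<Longrightarrow> F \<subseteq> I \<Longrightarrow> card F \<le> card (E `` F)"
  shows "\<exists>f. inj_on f I \<and> (\<forall>i\<in>I. (i, f i) \<in> E)"
proof -
  define H where "H = (\<lambda>R :: ('a \<times> 'b) set. \<forall>F. finite F \<longrightarrow> F \<subseteq> I \<longrightarrow> card F \<le> card (R `` F))"
  \<comment> \<open>The members are sets of deleted edges: a maximal deletion leaves a minimal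
    subrelation with Hall's condition.\<close>
  define \<A> where "\<A> = {D. D \<subseteq> E \<and> H (E - D)}"
  have fin_image: "finite (E `` F)" if "finite F" "F \<subseteq> I" for F
  proof -
    have "E `` F = (\<Union>i\<in>F. E `` {i})" by blast
    then show ?thesis using fin that by auto
  qed
  have "\<exists>D\<in>\<A>. \<forall>D'\<in>\<A>. D \<subseteq> D' \<longrightarrow> D' = D"
  proof (rule subset_Zorn_nonempty)
    show "\<A> \<noteq> {}" using hall by (auto simp: \<A>_def H_def intro!: exI[of _ "{}"])
    fix C assume C: "C \<noteq> {}" "subset.chain \<A> C"
    \<comment> \<open>Only finitely many edges leave \<open>F\<close>, so what the union of the
      chain deletes among them is already deleted by a single member.\<close>
    have "card F \<le> card ((E - \<Union>C) `` F)" if F: "finite F" "F \<subseteq> I" for F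
    proof -
      have "E \<inter> F \<times> UNIV \<subseteq> F \<times> (E `` F)" by blast
      then have "finite (E \<inter> F \<times> UNIV)"
        using fin_image[OF F] F(1) finite_subset by blast
      then obtain B where B: "B \<in> C" "(E \<inter> F \<times> UNIV) \<inter> \<Union>C \<subseteq> B"
        using finite_subset_Union_chain[of "(E \<inter> F \<times> UNIV) \<inter> \<Union>C" C \<A>] C by auto
      have "B \<in> \<A>" using B C by (auto simp: subset_chain_def)
      then have "card F \<le> card ((E - B) `` F)" using F by (auto simp: \<A>_def H_def)
      moreover have "(E - B) `` F = (E - \<Union>C) `` F" using B by blast
      ultimately show ?thesis by simp
    qed
    moreover have "\<Union>C \<subseteq> E" using C by (auto simp: subset_chain_def \<A>_def)
    ultimately show "\<Union>C \<in> \<A>" by (auto simp: \<A>_def H_def)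
  qed
  then obtain D where D: "D \<in> \<A>" and max: "\<And>D'. D' \<in> \<A> \<Longrightarrow> D \<subseteq> D' \<Longrightarrow> D' = D" by blast
  define R where "R = E - D"
  have HR: "card F \<le> card (R `` F)" if "finite F" "F \<subseteq> I" for F
    using D that by (auto simp: \<A>_def H_def R_def)
  have finR: "finite (R `` F)" if "finite F" "F \<subseteq> I" for F
    using fin_image[OF that] by (rule rev_finite_subset) (auto simp: R_def)
  \<comment> \<open>Every remaining edge is indispensable. A finite set violating Hall's condition
    once (n, p) is deleted must contain n, since otherwise its neighbours would not change;
    \<open>G\<close> is this set without n.\<close>
  have critical: "\<exists>G. finite G \<and> G \<subseteq> I \<and> n \<notin> G \<and> card (R `` G \<union> (R `` {n} - {p})) \<le> card G"
    if e: "(n, p) \<in> R" "n \<in> I" for n p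
  proof -
    have "insert (n, p) D \<notin> \<A>" using max[of "insert (n, p) D"] e by (auto simp: R_def)
    moreover have "insert (n, p) D \<subseteq> E" using e D by (auto simp: R_def \<A>_def)
    ultimately have "\<not> H (E - insert (n, p) D)" by (simp add: \<A>_def)
    moreover have "E - insert (n, p) D = R - {(n, p)}" by (auto simp: R_def)
    ultimately obtain F where F: "finite F" "F \<subseteq> I" "card ((R - {(n, p)}) `` F) < card F"
      by (auto simp: H_def not_le)
    have "n \<in> F"
    proof (rule ccontr)
      assume "n \<notin> F"
      then have "(R - {(n, p)}) `` F = R `` F" by blast
      then show False using F HR[of F] by simp
    qed
    then have "(R - {(n, p)}) `` F = R `` (F - {n}) \<union> (R `` {n} - {p})" by blast
    moreover have "card F = Suc (card (F - {n}))"
      using \<open>n \<in> F\<close> F(1) by (metis card.remove)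
    ultimately show ?thesis using F by (intro exI[of _ "F - {n}"]) auto
  qed
  \<comment> \<open>Submodular counting. With two edges at n and tight sets \<open>F\<close>,
    \<open>G\<close> for them, \<open>?A \<union> ?B\<close> contains all neighbours of n and so has
    at least \<open>card (F \<union> G) + 1\<close> elements, while \<open>?A \<inter> ?B\<close>
    has at least \<open>card (F \<inter> G)\<close>. The sum exceeds \<open>card F + card G\<close>,
    contrary to tightness.\<close>
  have unique: "p = q" if pq: "(n, p) \<in> R" "(n, q) \<in> R" and n: "n \<in> I" for n p q
  proof (rule ccontr)
    assume "p \<noteq> q"
    obtain F where F: "finite F" "F \<subseteq> I" "n \<notin> F" "card (R `` F \<union> (R `` {n} - {p})) \<le> card F"
      using critical[OF pq(1) n] by blast
    obtain G where G: "finite G" "G \<subseteq> I" "n \<notin> G" "card (R `` G \<union> (R `` {n} - {q})) \<le> card G"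
      using critical[OF pq(2) n] by blast
    let ?A = "R `` F \<union> (R `` {n} - {p})" and ?B = "R `` G \<union> (R `` {n} - {q})"
    have fin_AB: "finite ?A" "finite ?B"
      using finR[OF F(1,2)] finR[OF G(1,2)] finR[of "{n}"] n by auto
    have "?A \<union> ?B = R `` insert n (F \<union> G)" using \<open>p \<noteq> q\<close> by blast
    then have "card (insert n (F \<union> G)) \<le> card (?A \<union> ?B)"
      using HR[of "insert n (F \<union> G)"] F G n by simp
    then have "Suc (card (F \<union> G)) \<le> card (?A \<union> ?B)" using F G by simp
    moreover have "card (F \<inter> G) \<le> card (?A \<inter> ?B)"
    proof -
      have "card (F \<inter> G) \<le> card (R `` (F \<inter> G))" using HR F G by blast
      also have "\<dots> \<le> card (?A \<inter> ?B)" using fin_AB by (intro card_mono) auto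
      finally show ?thesis .
    qed
    moreover have "card ?A + card ?B = card (?A \<union> ?B) + card (?A \<inter> ?B)"
      using fin_AB by (rule card_Un_Int)
    moreover have "card F + card G = card (F \<union> G) + card (F \<inter> G)"
      using F G by (intro card_Un_Int)
    ultimately show False using F(4) G(4) by linarith
  qed
  have "\<exists>y. (n, y) \<in> R" if "n \<in> I" for n
    using HR[of "{n}"] that by (cases "R `` {n} = {}") auto
  then obtain f where f: "\<And>n. n \<in> I \<Longrightarrow> (n, f n) \<in> R" by metis
  have "inj_on f I"
  proof (rule inj_onI, rule ccontr)
    fix m n assume mn: "m \<in> I" "n \<in> I" "f m = f n" "m \<noteq> n"
    have "R `` {i} = {f i}" if "i \<in> I" for i
      using f[OF that] unique[OF _ f[OF that] that] by blast
    then have "R `` ({m} \<union> {n}) = {f n}" using mn by (simp only: Image_Un) simp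
    then have "R `` {m, n} = {f n}" by (simp add: insert_commute)
    then show False using HR[of "{m, n}"] mn by simp
  qed
  then show ?thesis using f by (auto simp: R_def)
qed

text \<open>Counting edges: \<pi> maps \<open>S \<times> F\<close> injectively into the product of
  \<open>S\<close> with the set of neighbours of \<open>F\<close>, and cancelling
  \<open>card S\<close> leaves Hall's condition. The relation \<open>E\<close> may forget
  multiplicities, for only the counting uses them.\<close>

lemma regular_bipartite_injection:
  assumes S: "finite S" "S \<noteq> {}" and \<pi>: "inj_on \<pi> (S \<times> N)" "\<pi> ` (S \<times> N) \<subseteq> S \<times> M"
  shows "\<exists>f. inj_on f N \<and> (\<forall>n\<in>N. \<exists>i\<in>S. \<exists>j\<in>S. f n \<in> M \<and> \<pi> (i, n) = (j, f n))"
proof -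
  define E where "E = {(n, m). n \<in> N \<and> (\<exists>i\<in>S. \<exists>j\<in>S. \<pi> (i, n) = (j, m))}"
  have fin: "finite (E `` F)" if "finite F" for F
  proof -
    have "E `` F \<subseteq> (snd \<circ> \<pi>) ` (S \<times> F)" by (force simp: E_def image_iff)
    then show ?thesis using S that finite_subset by blast
  qed
  have "card F \<le> card (E `` F)" if F: "finite F" "F \<subseteq> N" for F
  proof -
    have "\<pi> ` (S \<times> F) \<subseteq> S \<times> E `` F"
    proof (rule image_subsetI)
      fix z assume z: "z \<in> S \<times> F"
      then have "\<pi> z \<in> S \<times> M" using \<pi>(2) F(2) by blast
      then show "\<pi> z \<in> S \<times> E `` F" using z F(2) by (cases z, cases "\<pi> z") (force simp: E_def)
    qed
    moreover have "inj_on \<pi> (S \<times> F)" using \<pi>(1) by (rule inj_on_subset) (use F in blast)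
    ultimately have "card (S \<times> F) \<le> card (S \<times> E `` F)"
      using S fin F by (intro card_inj_on_le[of \<pi>]) auto
    then show ?thesis using S by (simp add: card_cartesian_product card_gt_0_iff)
  qed
  then obtain f where "inj_on f N" "\<forall>n\<in>N. (n, f n) \<in> E"
    using hall_marriage[of N E] fin by auto
  moreover have "m \<in> M" if "\<pi> (i, n) = (j, m)" "i \<in> S" "n \<in> N" for i j n m
    using \<pi>(2) that by (metis SigmaE2 SigmaI image_subset_iff)
  ultimately show ?thesis by (intro exI[of _ f]) (auto simp: E_def)
qed

text \<open>The bare existence of a bijection would not do: each pair (a, h a) must come from
  \<open>f\<close>, or from \<open>g\<close> read backwards, so that it is still an edge of the
  graph.\<close>

lemma Schroeder_Bernstein_union:
  assumes f: "inj_on f A" "f ` A \<subseteq> B" and g: "inj_on g B" "g ` B \<subseteq> A"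
  shows "\<exists>h. bij_betw h A B \<and> (\<forall>a\<in>A. h a = f a \<or> g (h a) = a)"
proof -
  \<comment> \<open>By injectivity of \<open>g\<close> this is the least set that contains the
    points of \<open>A\<close> outside the range of \<open>g\<close> and is stable under
    \<open>g\<close> after \<open>f\<close>; \<open>f\<close> is used on it and the inverse of
    \<open>g\<close> off it.\<close>
  define X where "X = lfp (\<lambda>X. A - g ` (B - f ` X))"
  have X: "X = A - g ` (B - f ` X)"
    unfolding X_def by (rule lfp_unfold) (blast intro: monoI)
  define g' where "g' = the_inv_into (B - f ` X) g"
  define h where "h = (\<lambda>a. if a \<in> X then f a else g' a)"
  have inj: "inj_on g (B - f ` X)" using g(1) by (rule inj_on_subset) blast
  have img: "g ` (B - f ` X) = A - X" using X g(2) by blast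
  have "bij_betw f X (f ` X)"
    using f(1) X by (intro inj_on_imp_bij_betw) (metis Diff_subset inj_on_subset)
  then have "bij_betw h X (f ` X)" by (rule bij_betw_cong[THEN iffD1, rotated]) (simp add: h_def)
  moreover have "bij_betw g' (A - X) (B - f ` X)"
    unfolding g'_def by (rule bij_betw_the_inv_into) (simp add: bij_betw_def inj img)
  then have "bij_betw h (A - X) (B - f ` X)"
    by (rule bij_betw_cong[THEN iffD1, rotated]) (simp add: h_def)
  ultimately have "bij_betw h (X \<union> (A - X)) (f ` X \<union> (B - f ` X))"
    by (rule bij_betw_combine) blast
  moreover have "X \<union> (A - X) = A" "f ` X \<union> (B - f ` X) = B" using X f(2) by blast+
  moreover have "h a = f a \<or> g (h a) = a" if "a \<in> A" for a
    using that f_the_inv_into_f[OF inj, of a] img by (auto simp: h_def g'_def)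
  ultimately show ?thesis by (intro exI[of _ h]) simp
qed

text \<open>For infinite index sets an injection along edges may miss points of the other side, so
  the graph is also read from \<open>M\<close> to \<open>N\<close> through the inverse of
  \<pi>.\<close>

lemma regular_bipartite_perfect_matching:
  assumes S: "finite S" "S \<noteq> {}" and \<pi>: "bij_betw \<pi> (S \<times> N) (S \<times> M)"
  shows "\<exists>\<sigma>. bij_betw \<sigma> N M \<and> (\<forall>n\<in>N. \<exists>i\<in>S. \<exists>j\<in>S. \<pi> (i, n) = (j, \<sigma> n))"
proof -
  let ?\<pi>' = "the_inv_into (S \<times> N) \<pi>"
  have \<pi>': "bij_betw ?\<pi>' (S \<times> M) (S \<times> N)" using \<pi> by (rule bij_betw_the_inv_into)
  obtain f where f: "inj_on f N" "\<forall>n\<in>N. \<exists>i\<in>S. \<exists>j\<in>S. f n \<in> M \<and> \<pi> (i, n) = (j, f n)"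
    using regular_bipartite_injection[OF S, of \<pi> N M] \<pi> by (auto simp: bij_betw_def)
  obtain g where g: "inj_on g M" "\<forall>m\<in>M. \<exists>j\<in>S. \<exists>i\<in>S. g m \<in> N \<and> ?\<pi>' (j, m) = (i, g m)"
    using regular_bipartite_injection[OF S, of ?\<pi>' M N] \<pi>' by (auto simp: bij_betw_def)
  obtain \<sigma> where \<sigma>: "bij_betw \<sigma> N M" "\<forall>n\<in>N. \<sigma> n = f n \<or> g (\<sigma> n) = n"
    using Schroeder_Bernstein_union[of f N M g] f g by blast
  have "\<exists>i\<in>S. \<exists>j\<in>S. \<pi> (i, n) = (j, \<sigma> n)" if n: "n \<in> N" for n
  proof (cases "\<sigma> n = f n")
    case True
    then show ?thesis using f n by auto
  next
    case False
    then have gn: "g (\<sigma> n) = n" using \<sigma> n by blast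
    have m: "\<sigma> n \<in> M" using \<sigma>(1) n by (auto simp: bij_betw_def)
    then obtain i j where ij: "i \<in> S" "j \<in> S" "?\<pi>' (j, \<sigma> n) = (i, n)" using g(2) gn by metis
    then have "\<pi> (i, n) = (j, \<sigma> n)"
      using f_the_inv_into_f_bij_betw[OF \<pi>, of "(j, \<sigma> n)"] m by auto
    then show ?thesis using ij by blast
  qed
  then show ?thesis using \<sigma>(1) by blast
qed

section \<open>Unconditional bases\<close>

context quasi_normed_space
begin

lemma unconditionally_sums_iff:
  assumes u: "\<And>n. n \<in> N \<Longrightarrow> u n \<in> qcarrier X" and f: "f \<in> qcarrier X"
  shows "unconditionally_sums X N u f \<longleftrightarrow>
    (\<forall>\<epsilon>>0. \<exists>B\<^sub>0. finite B\<^sub>0 \<and> B\<^sub>0 \<subseteq> N \<and>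
       (\<forall>B. finite B \<longrightarrow> B\<^sub>0 \<subseteq> B \<longrightarrow> B \<subseteq> N \<longrightarrow> qnorm X ((\<Sum>n\<in>B. u n) - f) < \<epsilon>))"
proof -
  have "\<bar>qnorm X ((\<Sum>n\<in>B. u n) - f)\<bar> = qnorm X ((\<Sum>n\<in>B. u n) - f)" if "B \<subseteq> N" for B
    using that u f by (intro abs_of_nonneg norm_nonneg diff_in sum_in) auto
  then show ?thesis
    unfolding unconditionally_sums_def tendsto_iff eventually_finite_subsets_at_top dist_real_def
    by (simp add: conj_commute) (metis (no_types, lifting))
qed

lemma unconditionally_sums_cong:
  assumes "\<And>n. n \<in> N \<Longrightarrow> u n = v n"
  shows "unconditionally_sums X N u f \<longleftrightarrow> unconditionally_sums X N v f"
  unfolding unconditionally_sums_def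
  by (rule tendsto_cong, rule eventually_finite_subsets_at_top_weakI)
     (use assms in \<open>auto intro!: arg_cong[where f = "\<lambda>s. qnorm X (s - f)"] sum.cong\<close>)

lemma unconditionally_sums_add:
  assumes u: "\<And>n. n \<in> N \<Longrightarrow> u n \<in> qcarrier X" and f: "f \<in> qcarrier X"
    and v: "\<And>n. n \<in> N \<Longrightarrow> v n \<in> qcarrier X" and g: "g \<in> qcarrier X"
    and "unconditionally_sums X N u f" "unconditionally_sums X N v g"
  shows "unconditionally_sums X N (\<lambda>n. u n + v n) (f + g)"
  unfolding unconditionally_sums_def
proof (rule tendsto_sandwich[OF _ _ tendsto_const])
  let ?r = "\<lambda>B. \<kappa> * (qnorm X ((\<Sum>n\<in>B. u n) - f) + qnorm X ((\<Sum>n\<in>B. v n) - g))"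
  have in_V: "(\<Sum>n\<in>B. u n) - f \<in> qcarrier X" "(\<Sum>n\<in>B. v n) - g \<in> qcarrier X" if "B \<subseteq> N" for B
    using that u v f g by (blast intro: diff_in sum_in)+
  have eq: "(\<Sum>n\<in>B. u n + v n) - (f + g) = ((\<Sum>n\<in>B. u n) - f) + ((\<Sum>n\<in>B. v n) - g)" for B
    by (simp add: sum.distrib)
  show "\<forall>\<^sub>F B in finite_subsets_at_top N. 0 \<le> qnorm X ((\<Sum>n\<in>B. u n + v n) - (f + g))"
    unfolding eq by (rule eventually_finite_subsets_at_top_weakI) (intro norm_nonneg add_in in_V)
  show "\<forall>\<^sub>F B in finite_subsets_at_top N. qnorm X ((\<Sum>n\<in>B. u n + v n) - (f + g)) \<le> ?r B"
    unfolding eq by (rule eventually_finite_subsets_at_top_weakI) (intro norm_triangle in_V)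
  have "(?r \<longlongrightarrow> \<kappa> * (0 + 0)) (finite_subsets_at_top N)"
    using assms(5,6) unfolding unconditionally_sums_def by (intro tendsto_intros)
  then show "(?r \<longlongrightarrow> 0) (finite_subsets_at_top N)" by simp
qed

lemma unconditionally_sums_scale:
  assumes u: "\<And>n. n \<in> N \<Longrightarrow> u n \<in> qcarrier X" and f: "f \<in> qcarrier X"
    and "unconditionally_sums X N u f"
  shows "unconditionally_sums X N (\<lambda>n. qscale X c (u n)) (qscale X c f)"
proof -
  have "((\<lambda>B. norm c * qnorm X ((\<Sum>n\<in>B. u n) - f)) \<longlongrightarrow> norm c * 0) (finite_subsets_at_top N)"
    using assms(3) unfolding unconditionally_sums_def by (intro tendsto_intros)
  moreover have "\<forall>\<^sub>F B in finite_subsets_at_top N. norm c * qnorm X ((\<Sum>n\<in>B. u n) - f) =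
      qnorm X ((\<Sum>n\<in>B. qscale X c (u n)) - qscale X c f)"
  proof (rule eventually_finite_subsets_at_top_weakI)
    fix B assume "B \<subseteq> N"
    then have "(\<Sum>n\<in>B. u n) - f \<in> qcarrier X" using u f by (blast intro: diff_in sum_in)
    from norm_scale[OF this, of c]
    show "norm c * qnorm X ((\<Sum>n\<in>B. u n) - f) =
      qnorm X ((\<Sum>n\<in>B. qscale X c (u n)) - qscale X c f)"
      by (simp add: scale_sum_right scale_right_diff_distrib)
  qed
  ultimately show ?thesis unfolding unconditionally_sums_def
    by (simp add: tendsto_cong)
qed

lemma unconditionally_sums_unique:
  assumes u: "\<And>n. n \<in> N \<Longrightarrow> u n \<in> qcarrier X" and f: "f \<in> qcarrier X" and g: "g \<in> qcarrier X"
    and "unconditionally_sums X N u f" "unconditionally_sums X N u g"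
  shows "f = g"
proof -
  let ?r = "\<lambda>B. \<kappa> * (qnorm X ((\<Sum>n\<in>B. u n) - f) + qnorm X ((\<Sum>n\<in>B. u n) - g))"
  have "(?r \<longlongrightarrow> \<kappa> * (0 + 0)) (finite_subsets_at_top N)"
    using assms(4,5) unfolding unconditionally_sums_def by (intro tendsto_intros)
  moreover have "\<forall>\<^sub>F B in finite_subsets_at_top N. qnorm X (f - g) \<le> ?r B"
  proof (rule eventually_finite_subsets_at_top_weakI)
    fix B assume "B \<subseteq> N"
    then have "(\<Sum>n\<in>B. u n) \<in> qcarrier X" using u by (blast intro: sum_in)
    then show "qnorm X (f - g) \<le> ?r B"
      using norm_triangle_via[OF f g] norm_minus_commute f by (metis order_refl)
  qed
  ultimately have "qnorm X (f - g) \<le> \<kappa> * (0 + 0)"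
    by (intro tendsto_lowerbound) auto
  then have "qnorm X (f - g) = 0" using norm_nonneg[OF diff_in[OF f g]] by simp
  then show ?thesis using norm_eq_0[OF diff_in[OF f g]] by simp
qed

lemma norm_sum_tendsto_zero:
  assumes "finite B" and "\<And>j n. n \<in> B \<Longrightarrow> v j n \<in> qcarrier X"
    and "\<And>n. n \<in> B \<Longrightarrow> (\<lambda>j. qnorm X (v j n)) \<longlonglongrightarrow> 0"
  shows "(\<lambda>j. qnorm X (\<Sum>n\<in>B. v j n)) \<longlonglongrightarrow> 0"
  using assms
proof (induction B)
  case (insert n B)
  let ?r = "\<lambda>j. \<kappa> * (qnorm X (v j n) + qnorm X (\<Sum>n\<in>B. v j n))"
  have in_V: "v j n \<in> qcarrier X" "(\<Sum>n\<in>B. v j n) \<in> qcarrier X" for j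
    using insert.prems by (auto intro: sum_in)
  have "?r \<longlonglongrightarrow> \<kappa> * (0 + 0)" using insert by (intro tendsto_intros) auto
  then have lim: "?r \<longlonglongrightarrow> 0" by simp
  show ?case
  proof (rule tendsto_sandwich[OF always_eventually always_eventually tendsto_const lim])
    show "\<forall>j. 0 \<le> qnorm X (\<Sum>n\<in>insert n B. v j n)"
      using insert.prems by (intro allI norm_nonneg sum_in) auto
    show "\<forall>j. qnorm X (\<Sum>n\<in>insert n B. v j n) \<le> ?r j"
      using insert.hyps in_V norm_triangle by simp
  qed
qed simp

end

section \<open>Coefficients and uniform boundedness of the partial sums\<close>

locale unconditional_basis_space = quasi_banach_space X \<kappa>
  for X :: "('k::{real_normed_field,banach}, 'a::ab_group_add) qspace" and \<kappa> +
  fixes N :: "'i set" and x :: "'i \<Rightarrow> 'a"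
  assumes basis: "unconditional_basis X N x"
begin

definition coef :: "'a \<Rightarrow> 'i \<Rightarrow> 'k" where
  "coef f = (THE a. a \<in> extensional N \<and> unconditionally_sums X N (\<lambda>n. qscale X (a n) (x n)) f)"

definition psum :: "'a \<Rightarrow> 'i set \<Rightarrow> 'a" where
  "psum f B = (\<Sum>n\<in>B. qscale X (coef f n) (x n))"

lemma x_in: "n \<in> N \<Longrightarrow> x n \<in> qcarrier X"
  using basis by (auto simp: unconditional_basis_def unconditional_basic_sequence_def)

lemma closed_span_eq: "closed_span X N x = qcarrier X"
  using basis by (auto simp: unconditional_basis_def)

lemma scale_x_in: "n \<in> N \<Longrightarrow> qscale X c (x n) \<in> qcarrier X"
  using x_in scale_in by blast

lemma ex1_coef:
  assumes "f \<in> qcarrier X"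
  shows "\<exists>!a. a \<in> extensional N \<and> unconditionally_sums X N (\<lambda>n. qscale X (a n) (x n)) f"
  using basis assms by (simp add: unconditional_basis_def unconditional_basic_sequence_def)

lemma coef_sums:
  assumes "f \<in> qcarrier X"
  shows "unconditionally_sums X N (\<lambda>n. qscale X (coef f n) (x n)) f"
  using theI'[OF ex1_coef[OF assms]] by (simp add: coef_def)

lemma coef_eqI:
  assumes f: "f \<in> qcarrier X" and a: "unconditionally_sums X N (\<lambda>n. qscale X (a n) (x n)) f"
    and n: "n \<in> N"
  shows "coef f n = a n"
proof -
  \<comment> \<open>Uniqueness of the coefficients is available only among members of
    \<open>extensional N\<close>.\<close>
  have "unconditionally_sums X N (\<lambda>n. qscale X (restrict a N n) (x n)) f"
    using a by (subst unconditionally_sums_cong[where v = "\<lambda>n. qscale X (a n) (x n)"]) auto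
  then have "coef f = restrict a N"
    unfolding coef_def by (intro the1_equality[OF ex1_coef[OF f]]) auto
  then show ?thesis using n by simp
qed

lemma coef_add:
  assumes "f \<in> qcarrier X" "g \<in> qcarrier X" "n \<in> N"
  shows "coef (f + g) n = coef f n + coef g n"
  using unconditionally_sums_add[OF _ _ _ _ coef_sums coef_sums, of f g] assms scale_x_in add_in
  by (intro coef_eqI) (simp_all add: scale_left_distrib)

lemma coef_scale:
  assumes "f \<in> qcarrier X" "n \<in> N"
  shows "coef (qscale X c f) n = c * coef f n"
  using unconditionally_sums_scale[OF _ _ coef_sums, of f c] assms scale_x_in scale_in
  by (intro coef_eqI) simp_all

lemma coef_diff:
  assumes "f \<in> qcarrier X" "g \<in> qcarrier X" "n \<in> N"
  shows "coef (f - g) n = coef f n - coef g n"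
  using coef_add[of f "- g" n] coef_scale[of g n "-1"] assms neg_in by simp

lemma coef_x:
  assumes "m \<in> N" "n \<in> N"
  shows "coef (x m) n = (if n = m then 1 else 0)"
proof (rule coef_eqI[OF x_in[OF assms(1)] _ assms(2)])
  have "qnorm X ((\<Sum>n\<in>B. qscale X (if n = m then 1 else 0) (x n)) - x m) = 0"
    if "finite B" "{m} \<subseteq> B" for B
  proof -
    have "(\<Sum>n\<in>B. qscale X (if n = m then 1 else 0) (x n)) = (\<Sum>n\<in>B. if n = m then x n else 0)"
      by (intro sum.cong) auto
    then show ?thesis using that by (simp add: sum.delta)
  qed
  then show "unconditionally_sums X N (\<lambda>n. qscale X (if n = m then 1 else 0) (x n)) (x m)"
    using assms(1) scale_x_in x_in by (subst unconditionally_sums_iff) (auto intro!: exI[of _ "{m}"])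
qed

lemma x_nonzero:
  assumes "n \<in> N"
  shows "x n \<noteq> 0"
proof
  assume "x n = 0"
  then have "coef (x n) n = 0"
    using coef_scale[OF zero_in assms, of 0] by simp
  then show False using coef_x[OF assms assms] by simp
qed

lemma psum_in: "B \<subseteq> N \<Longrightarrow> psum f B \<in> qcarrier X"
  unfolding psum_def using scale_x_in by (blast intro: sum_in)

lemma psum_add:
  "f \<in> qcarrier X \<Longrightarrow> g \<in> qcarrier X \<Longrightarrow> B \<subseteq> N \<Longrightarrow> psum (f + g) B = psum f B + psum g B"
  unfolding psum_def sum.distrib[symmetric]
  by (intro sum.cong) (auto simp: coef_add scale_left_distrib)

lemma psum_scale:
  "f \<in> qcarrier X \<Longrightarrow> B \<subseteq> N \<Longrightarrow> psum (qscale X c f) B = qscale X c (psum f B)"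
  unfolding psum_def scale_sum_right by (intro sum.cong) (auto simp: coef_scale)

lemma psum_diff:
  "f \<in> qcarrier X \<Longrightarrow> g \<in> qcarrier X \<Longrightarrow> B \<subseteq> N \<Longrightarrow> psum (f - g) B = psum f B - psum g B"
  unfolding psum_def sum_subtractf[symmetric]
  by (intro sum.cong) (auto simp: coef_diff scale_left_diff_distrib)

lemma psum_Un_disjoint:
  "finite B \<Longrightarrow> finite D \<Longrightarrow> B \<inter> D = {} \<Longrightarrow> psum f (B \<union> D) = psum f B + psum f D"
  unfolding psum_def by (rule sum.union_disjoint)

lemma psum_near:
  assumes "f \<in> qcarrier X" "\<epsilon> > 0"
  obtains B\<^sub>0 where "finite B\<^sub>0" "B\<^sub>0 \<subseteq> N"
    "\<And>B. finite B \<Longrightarrow> B\<^sub>0 \<subseteq> B \<Longrightarrow> B \<subseteq> N \<Longrightarrow> qnorm X (psum f B - f) < \<epsilon>"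
proof -
  have "\<exists>B\<^sub>0. finite B\<^sub>0 \<and> B\<^sub>0 \<subseteq> N \<and>
     (\<forall>B. finite B \<longrightarrow> B\<^sub>0 \<subseteq> B \<longrightarrow> B \<subseteq> N \<longrightarrow> qnorm X (psum f B - f) < \<epsilon>)"
    using coef_sums[OF assms(1)] assms scale_x_in
    by (subst (asm) unconditionally_sums_iff) (auto simp: psum_def)
  then show thesis using that by blast
qed

text \<open>Both the sum over \<open>B\<^sub>0\<close> and the sum over its union with
  \<open>D\<close> are close to \<open>f\<close>; the contribution of \<open>D\<close> is the
  difference of these two errors.\<close>

lemma psum_tail_small:
  assumes f: "f \<in> qcarrier X" and B0: "finite B\<^sub>0" "B\<^sub>0 \<subseteq> N"
    and near: "\<And>B. finite B \<Longrightarrow> B\<^sub>0 \<subseteq> B \<Longrightarrow> B \<subseteq> N \<Longrightarrow> qnorm X (psum f B - f) < \<epsilon>"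
    and D: "finite D" "D \<subseteq> N" "D \<inter> B\<^sub>0 = {}"
  shows "qnorm X (psum f D) \<le> \<kappa> * (\<epsilon> + \<epsilon>)"
proof -
  have "psum f D = (psum f (B\<^sub>0 \<union> D) - f) - (psum f B\<^sub>0 - f)"
    using psum_Un_disjoint[of "B\<^sub>0" D f] B0 D by (simp add: Int_commute)
  moreover have "qnorm X (psum f (B\<^sub>0 \<union> D) - f) < \<epsilon>" "qnorm X (psum f B\<^sub>0 - f) < \<epsilon>"
    using B0 D by (auto intro!: near)
  ultimately show ?thesis
    using norm_triangle_diff_le[of "psum f (B\<^sub>0 \<union> D) - f" "psum f B\<^sub>0 - f" \<epsilon> \<epsilon>]
      diff_in[OF psum_in f] B0 D by auto
qed

text \<open>Beyond a finite \<open>B\<^sub>0\<close> all contributions are small, and inside it only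
  finitely many subsets occur; summing their norms is a crude substitute for a maximum.\<close>

lemma psum_pointwise_bounded:
  assumes f: "f \<in> qcarrier X"
  shows "\<exists>c. \<forall>B. finite B \<longrightarrow> B \<subseteq> N \<longrightarrow> qnorm X (psum f B) \<le> c"
proof -
  obtain B\<^sub>0 where B0: "finite B\<^sub>0" "B\<^sub>0 \<subseteq> N"
    and near: "\<And>B. finite B \<Longrightarrow> B\<^sub>0 \<subseteq> B \<Longrightarrow> B \<subseteq> N \<Longrightarrow> qnorm X (psum f B - f) < 1"
    using psum_near[OF f, of 1] by auto
  define c where "c = (\<Sum>D\<in>Pow B\<^sub>0. qnorm X (psum f D))"
  have "qnorm X (psum f B) \<le> \<kappa> * (c + \<kappa> * (1 + 1))" if B: "finite B" "B \<subseteq> N" for B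
  proof -
    have "psum f B = psum f (B \<inter> B\<^sub>0) + psum f (B - B\<^sub>0)"
      using psum_Un_disjoint[of "B \<inter> B\<^sub>0" "B - B\<^sub>0" f] B B0
      by (metis Int_Diff_disjoint Int_Diff_Un finite_Diff finite_Int)
    moreover have "qnorm X (psum f (B \<inter> B\<^sub>0)) \<le> c"
      unfolding c_def using B0
      by (intro member_le_sum[of "B \<inter> B\<^sub>0" "Pow B\<^sub>0" "\<lambda>D. qnorm X (psum f D)"])
         (auto intro!: norm_nonneg psum_in)
    moreover have "qnorm X (psum f (B - B\<^sub>0)) \<le> \<kappa> * (1 + 1)"
      by (rule psum_tail_small[OF f B0 near]) (use B in auto)
    moreover have "psum f (B \<inter> B\<^sub>0) \<in> qcarrier X" "psum f (B - B\<^sub>0) \<in> qcarrier X"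
      using B by (auto intro!: psum_in)
    ultimately show ?thesis by (simp add: norm_triangle_le)
  qed
  then show ?thesis by blast
qed

text \<open>The partial sum operators are not yet known to be continuous one by one, so the uniform
  boundedness principle cannot be invoked. Instead the supremum of the norms of all finite partial
  sums, finite at each point, plays the stronger quasi-norm. The value \<open>L = \<kappa>\<close>
  is the loss in passing to limits of partial sums.\<close>

lemma psum_uniformly_bounded:
  "\<exists>K\<ge>0. \<forall>f\<in>qcarrier X. \<forall>B. finite B \<longrightarrow> B \<subseteq> N \<longrightarrow> qnorm X (psum f B) \<le> K * qnorm X f"
proof (rule stronger_norm_bounded
    [where W = "\<lambda>c f. \<forall>B. finite B \<longrightarrow> B \<subseteq> N \<longrightarrow> qnorm X (psum f B) \<le> c" and L = \<kappa>])
  show "\<exists>c. \<forall>B. finite B \<longrightarrow> B \<subseteq> N \<longrightarrow> qnorm X (psum f B) \<le> c" if "f \<in> qcarrier X" for f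
    using psum_pointwise_bounded[OF that] .
  have "psum 0 B = 0" if "B \<subseteq> N" for B
    using psum_scale[OF zero_in that, of 0] by simp
  then show "\<forall>B. finite B \<longrightarrow> B \<subseteq> N \<longrightarrow> qnorm X (psum 0 B) \<le> 0" by simp
  show "\<forall>B. finite B \<longrightarrow> B \<subseteq> N \<longrightarrow> qnorm X (psum (f + g) B) \<le> \<kappa> * (c + d)"
    if "f \<in> qcarrier X" "g \<in> qcarrier X"
      "\<forall>B. finite B \<longrightarrow> B \<subseteq> N \<longrightarrow> qnorm X (psum f B) \<le> c"
      "\<forall>B. finite B \<longrightarrow> B \<subseteq> N \<longrightarrow> qnorm X (psum g B) \<le> d" for c d f g
    using that by (simp add: psum_add norm_triangle_le psum_in)
  show "\<forall>B. finite B \<longrightarrow> B \<subseteq> N \<longrightarrow> qnorm X (psum (qscale X t f) B) \<le> norm t * c"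
    if "f \<in> qcarrier X" "\<forall>B. finite B \<longrightarrow> B \<subseteq> N \<longrightarrow> qnorm X (psum f B) \<le> c" for c t f
    using that by (simp add: psum_scale norm_scale psum_in mult_left_mono)
next
  fix u f c
  assume u: "\<And>j. u j \<in> qcarrier X" and f: "f \<in> qcarrier X"
    and lim: "(\<lambda>j::nat. qnorm X (u j - f)) \<longlonglongrightarrow> 0"
    and Cauchy0: "\<And>\<epsilon>. \<epsilon> > 0 \<Longrightarrow> \<exists>J. \<forall>i\<ge>J. \<forall>j\<ge>J. \<forall>B. finite B \<longrightarrow> B \<subseteq> N \<longrightarrow> qnorm X (psum (u i - u j) B) \<le> \<epsilon>"
    and bound: "\<And>j. \<forall>B. finite B \<longrightarrow> B \<subseteq> N \<longrightarrow> qnorm X (psum (u j) B) \<le> c"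
  have Cauchy: "\<exists>J. \<forall>i\<ge>J. \<forall>j\<ge>J. \<forall>B. finite B \<longrightarrow> B \<subseteq> N \<longrightarrow> qnorm X (psum (u i) B - psum (u j) B) \<le> \<epsilon>"
    if "\<epsilon> > 0" for \<epsilon>
    using Cauchy0[OF that] u by (simp add: psum_diff)
  \<comment> \<open>The singleton {n} in the Cauchy condition, divided by the nonzero norm of
    \<open>x n\<close>, makes the coefficients at n a Cauchy sequence of scalars.\<close>
  have "\<exists>b. (\<lambda>j. coef (u j) n) \<longlonglongrightarrow> b" if n: "n \<in> N" for n
  proof -
    have xn: "qnorm X (x n) > 0"
      using norm_nonneg[OF x_in[OF n]] norm_eq_0[OF x_in[OF n]] x_nonzero[OF n] by linarith
    have "Cauchy (\<lambda>j. coef (u j) n)"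
    proof (rule CauchyI)
      fix e :: real assume "e > 0"
      then have "e / 2 * qnorm X (x n) > 0" using xn by simp
      from Cauchy[OF this] obtain J where J0: "\<forall>i\<ge>J. \<forall>j\<ge>J. \<forall>B. finite B \<longrightarrow> B \<subseteq> N \<longrightarrow>
          qnorm X (psum (u i) B - psum (u j) B) \<le> e / 2 * qnorm X (x n)" ..
      have J: "qnorm X (psum (u i) {n} - psum (u j) {n}) \<le> e / 2 * qnorm X (x n)"
        if "i \<ge> J" "j \<ge> J" for i j
        using J0[rule_format, OF that, of "{n}"] n by simp
      have "norm (coef (u i) n - coef (u j) n) < e" if "i \<ge> J" "j \<ge> J" for i j
      proof -
        have "psum (u i) {n} - psum (u j) {n} = qscale X (coef (u i) n - coef (u j) n) (x n)"
          by (simp add: psum_def scale_left_diff_distrib)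
        then have "norm (coef (u i) n - coef (u j) n) * qnorm X (x n) \<le> e / 2 * qnorm X (x n)"
          using J[OF that] norm_scale[OF x_in[OF n]] by simp
        then have "norm (coef (u i) n - coef (u j) n) \<le> e / 2" using xn by simp
        then show ?thesis using \<open>e > 0\<close> by simp
      qed
      then show "\<exists>M. \<forall>m\<ge>M. \<forall>k\<ge>M. norm (coef (u m) n - coef (u k) n) < e" by blast
    qed
    then show ?thesis using Cauchy_convergent convergent_def by blast
  qed
  then obtain b where b: "\<And>n. n \<in> N \<Longrightarrow> (\<lambda>j. coef (u j) n) \<longlonglongrightarrow> b n" by metis
  define S where "S = (\<lambda>B. \<Sum>n\<in>B. qscale X (b n) (x n))"
  have S_in: "S B \<in> qcarrier X" if "B \<subseteq> N" for B
    unfolding S_def using that scale_x_in by (blast intro: sum_in)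
  have S_lim: "(\<lambda>j. qnorm X (psum (u j) B - S B)) \<longlonglongrightarrow> 0" if B: "finite B" "B \<subseteq> N" for B
  proof -
    have "(\<lambda>j. qnorm X (\<Sum>n\<in>B. qscale X (coef (u j) n - b n) (x n))) \<longlonglongrightarrow> 0"
    proof (rule norm_sum_tendsto_zero[OF B(1)])
      fix n assume "n \<in> B"
      then have n: "n \<in> N" using B by blast
      then show "qscale X (coef (u j) n - b n) (x n) \<in> qcarrier X" for j by (rule scale_x_in)
      have "(\<lambda>j. norm (coef (u j) n - b n) * qnorm X (x n)) \<longlonglongrightarrow> 0 * qnorm X (x n)"
        using b[OF n] by (intro tendsto_intros tendsto_norm_zero LIM_zero)
      then show "(\<lambda>j. qnorm X (qscale X (coef (u j) n - b n) (x n))) \<longlonglongrightarrow> 0"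
        using norm_scale[OF x_in[OF n]] by simp
    qed
    then show ?thesis by (simp add: psum_def S_def scale_left_diff_distrib sum_subtractf)
  qed
  \<comment> \<open>Interchange of limits: the Cauchy condition is uniform in \<open>B\<close>, so
    after fixing one index \<open>J\<close>, a set \<open>B\<^sub>0\<close> good for
    \<open>u J\<close> is good for \<open>f\<close> too.\<close>
  have "unconditionally_sums X N (\<lambda>n. qscale X (b n) (x n)) f"
  proof (subst unconditionally_sums_iff, safe)
    fix \<epsilon> :: real assume "\<epsilon> > 0"
    \<comment> \<open>The three errors of size e enter with total weight
      3\<kappa>\<twosuperior>.\<close>
    define e where "e = \<epsilon> / (4 * \<kappa>\<^sup>2)"
    have e: "e > 0" "\<kappa> * (\<kappa> * e + \<kappa> * (e + e)) < \<epsilon>"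
      using \<open>\<epsilon> > 0\<close> kappa_ge_1 by (auto simp: e_def field_simps power2_eq_square)
    from Cauchy[OF e(1)] obtain J1 where J1: "\<forall>i\<ge>J1. \<forall>j\<ge>J1. \<forall>B. finite B \<longrightarrow> B \<subseteq> N \<longrightarrow>
        qnorm X (psum (u i) B - psum (u j) B) \<le> e" ..
    obtain J2 where J2: "\<And>j. j \<ge> J2 \<Longrightarrow> qnorm X (u j - f) < e"
      using order_tendstoD(2)[OF lim e(1)] by (auto simp: eventually_sequentially)
    define J where "J = max J1 J2"
    obtain B\<^sub>0 where B0: "finite B\<^sub>0" "B\<^sub>0 \<subseteq> N"
      and near: "\<And>B. finite B \<Longrightarrow> B\<^sub>0 \<subseteq> B \<Longrightarrow> B \<subseteq> N \<Longrightarrow> qnorm X (psum (u J) B - u J) < e"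
      using psum_near[OF u e(1)] by metis
    have "qnorm X (S B - f) < \<epsilon>" if B: "finite B" "B\<^sub>0 \<subseteq> B" "B \<subseteq> N" for B
    proof -
      have "qnorm X (S B - psum (u J) B) \<le> \<kappa> * e"
        by (rule norm_limit_le[OF psum_in[OF B(3)] S_in[OF B(3)] S_lim[OF B(1,3)] psum_in[OF B(3)], of J])
          (use J1 B in \<open>auto simp: J_def\<close>)
      moreover have "qnorm X (psum (u J) B - f) \<le> \<kappa> * (e + e)"
        using near[OF B] J2[of J] by (intro norm_triangle_via[OF psum_in[OF B(3)] f u[of J]]) (auto simp: J_def)
      ultimately have "qnorm X (S B - f) \<le> \<kappa> * (\<kappa> * e + \<kappa> * (e + e))"
        by (rule norm_triangle_via[OF S_in[OF B(3)] f psum_in[OF B(3)]])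
      then show ?thesis using e(2) by simp
    qed
    then show "\<exists>B\<^sub>0. finite B\<^sub>0 \<and> B\<^sub>0 \<subseteq> N \<and> (\<forall>B. finite B \<longrightarrow> B\<^sub>0 \<subseteq> B \<longrightarrow> B \<subseteq> N \<longrightarrow>
        qnorm X ((\<Sum>n\<in>B. qscale X (b n) (x n)) - f) < \<epsilon>)"
      using B0 by (auto simp: S_def)
  qed (use f scale_x_in in auto)
  \<comment> \<open>Uniqueness of the expansion identifies the limits \<open>b\<close> as the
    coefficients of \<open>f\<close>, so that bounds for \<open>S\<close> become bounds for the
    partial sums of \<open>f\<close>.\<close>
  then have "coef f n = b n" if "n \<in> N" for n
    using coef_eqI[OF f _ that] by blast
  then have "psum f B = S B" if "B \<subseteq> N" for B
    unfolding psum_def S_def using that by (intro sum.cong) auto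
  moreover have "qnorm X (S B) \<le> \<kappa> * c" if B: "finite B" "B \<subseteq> N" for B
    using norm_limit_le[OF psum_in[OF B(2)] S_in[OF B(2)] S_lim[OF B] zero_in, of 0 c] bound B by simp
  ultimately show "\<forall>B. finite B \<longrightarrow> B \<subseteq> N \<longrightarrow> qnorm X (psum f B) \<le> \<kappa> * c" by simp
qed auto

end

section \<open>Bounded linear maps\<close>

text \<open>The upper half of \<open>isomorphic_embedding\<close>, with a nonnegative constant so
  that bounds can be composed. The domain is a set because the given equivalence is controlled only
  on a closed span.\<close>

definition bounded_linear_on ::
    "('k::{real_normed_field,banach}, 'a::ab_group_add) qspace \<Rightarrow> 'a set \<Rightarrow>
     ('k, 'b::ab_group_add) qspace \<Rightarrow> ('a \<Rightarrow> 'b) \<Rightarrow> bool" where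
  "bounded_linear_on X S Y T \<longleftrightarrow>
     (\<forall>f\<in>S. T f \<in> qcarrier Y) \<and>
     (\<forall>f\<in>S. \<forall>g\<in>S. T (f + g) = T f + T g) \<and>
     (\<forall>c. \<forall>f\<in>S. T (qscale X c f) = qscale Y c (T f)) \<and>
     (\<exists>C\<ge>0. \<forall>f\<in>S. qnorm Y (T f) \<le> C * qnorm X f)"

lemma bounded_linear_on_in: "bounded_linear_on X S Y T \<Longrightarrow> f \<in> S \<Longrightarrow> T f \<in> qcarrier Y"
  and bounded_linear_on_add:
    "bounded_linear_on X S Y T \<Longrightarrow> f \<in> S \<Longrightarrow> g \<in> S \<Longrightarrow> T (f + g) = T f + T g"
  and bounded_linear_on_scale:
    "bounded_linear_on X S Y T \<Longrightarrow> f \<in> S \<Longrightarrow> T (qscale X c f) = qscale Y c (T f)"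
  by (simp_all add: bounded_linear_on_def)

lemma bounded_linear_on_bound:
  assumes "bounded_linear_on X S Y T"
  obtains C where "C \<ge> 0" "\<And>f. f \<in> S \<Longrightarrow> qnorm Y (T f) \<le> C * qnorm X f"
  using assms by (auto simp: bounded_linear_on_def)

lemma bounded_linear_on_id: "bounded_linear_on X (qcarrier X) X (\<lambda>f. f)"
  unfolding bounded_linear_on_def by (auto intro!: exI[of _ 1])

lemma bounded_linear_on_comp:
  assumes T: "bounded_linear_on X S Y T" and U: "bounded_linear_on Y S' Z U" and sub: "T ` S \<subseteq> S'"
  shows "bounded_linear_on X S Z (\<lambda>f. U (T f))"
proof -
  obtain C where C: "C \<ge> 0" "\<And>f. f \<in> S \<Longrightarrow> qnorm Y (T f) \<le> C * qnorm X f"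
    using bounded_linear_on_bound[OF T] by blast
  obtain D where D: "D \<ge> 0" "\<And>f. f \<in> S' \<Longrightarrow> qnorm Z (U f) \<le> D * qnorm Y f"
    using bounded_linear_on_bound[OF U] by blast
  have "qnorm Z (U (T f)) \<le> (D * C) * qnorm X f" if f: "f \<in> S" for f
  proof -
    have "qnorm Z (U (T f)) \<le> D * qnorm Y (T f)" using D f sub by blast
    also have "\<dots> \<le> D * (C * qnorm X f)" using C(2)[OF f] D(1) by (rule mult_left_mono)
    finally show ?thesis by (simp add: mult_ac)
  qed
  moreover have "D * C \<ge> 0" using C D by simp
  ultimately show ?thesis
    using T U sub unfolding bounded_linear_on_def by (auto simp: image_subset_iff)
qed

lemma isomorphic_embedding_bounded_linear_on:
  assumes "isomorphic_embedding X S Y T" and "\<And>f. f \<in> S \<Longrightarrow> 0 \<le> qnorm X f"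
  shows "bounded_linear_on X S Y T"
proof -
  obtain C where C: "\<forall>f\<in>S. qnorm Y (T f) \<le> C * qnorm X f"
    using assms(1) by (auto simp: isomorphic_embedding_def)
  have "qnorm Y (T f) \<le> max C 0 * qnorm X f" if "f \<in> S" for f
    using C assms(2)[OF that] that
    by (meson max.cobounded1 mult_right_mono order_trans)
  then have "\<exists>C\<ge>0. \<forall>f\<in>S. qnorm Y (T f) \<le> C * qnorm X f"
    by (intro exI[of _ "max C 0"]) auto
  then show ?thesis
    using assms(1) unfolding bounded_linear_on_def isomorphic_embedding_def by blast
qed

context quasi_normed_space
begin

lemma bounded_linear_on_zero: "bounded_linear_on Z S X (\<lambda>f. 0)"
  unfolding bounded_linear_on_def by (auto intro!: exI[of _ 0] zero_in)

lemma bounded_linear_on_plus: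
  assumes T: "bounded_linear_on Z S X T" and U: "bounded_linear_on Z S X U"
  shows "bounded_linear_on Z S X (\<lambda>f. T f + U f)"
proof -
  obtain C where C: "C \<ge> 0" "\<And>f. f \<in> S \<Longrightarrow> qnorm X (T f) \<le> C * qnorm Z f"
    using bounded_linear_on_bound[OF T] by blast
  obtain D where D: "D \<ge> 0" "\<And>f. f \<in> S \<Longrightarrow> qnorm X (U f) \<le> D * qnorm Z f"
    using bounded_linear_on_bound[OF U] by blast
  have "qnorm X (T f + U f) \<le> (\<kappa> * (C + D)) * qnorm Z f" if f: "f \<in> S" for f
    using norm_triangle_le[OF _ _ C(2)[OF f] D(2)[OF f]] T U f
    by (simp add: bounded_linear_on_in algebra_simps)
  moreover have "\<kappa> * (C + D) \<ge> 0" using C D kappa_ge_1 by simp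
  ultimately have "\<exists>C\<ge>0. \<forall>f\<in>S. qnorm X (T f + U f) \<le> C * qnorm Z f" by blast
  then show ?thesis
    using T U unfolding bounded_linear_on_def by (simp add: add_in scale_right_distrib)
qed

lemma bounded_linear_on_uminus:
  assumes T: "bounded_linear_on Z S X T"
  shows "bounded_linear_on Z S X (\<lambda>f. - T f)"
  using T unfolding bounded_linear_on_def
  by (simp add: neg_in scale_minus_right norm_uminus)

lemma bounded_linear_on_sum:
  assumes "finite I" "\<And>i. i \<in> I \<Longrightarrow> bounded_linear_on Z S X (T i)"
  shows "bounded_linear_on Z S X (\<lambda>f. \<Sum>i\<in>I. T i f)"
  using assms
  by (induction I) (simp_all add: bounded_linear_on_zero bounded_linear_on_plus)

end

section \<open>Bounded maps on closed spans, and powers of a space\<close>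

lemma bounded_linear_on_span:
  assumes X: "quasi_normed_space X \<kappa>" and Y: "quasi_normed_space Y \<kappa>'"
    and T: "bounded_linear_on X (qcarrier X) Y T"
    and x: "\<And>n. n \<in> N \<Longrightarrow> x n \<in> qcarrier X"
    and Tx: "\<And>n. n \<in> N \<Longrightarrow> T (x n) \<in> module.span (qscale Y) B"
    and f: "f \<in> module.span (qscale X) (x ` N)"
  shows "f \<in> qcarrier X \<and> T f \<in> module.span (qscale Y) B"
proof -
  interpret X: quasi_normed_space X \<kappa> by fact
  interpret Y: quasi_normed_space Y \<kappa>' by fact
  show ?thesis
  proof (rule X.span_induct[OF f])
    have "T 0 = 0"
      using bounded_linear_on_scale[OF T X.zero_in, of 0] by simp
    then show "X.subspace {f. f \<in> qcarrier X \<and> T f \<in> Y.span B}"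
      using T by (intro X.subspaceI)
        (auto simp: bounded_linear_on_add bounded_linear_on_scale Y.span_zero Y.span_add Y.span_scale
          X.zero_in X.add_in X.scale_in)
  qed (use x Tx in auto)
qed

lemma bounded_linear_on_diff:
  assumes X: "quasi_normed_space X \<kappa>" and Y: "quasi_normed_space Y \<kappa>'"
    and T: "bounded_linear_on X (qcarrier X) Y T" and f: "f \<in> qcarrier X" and g: "g \<in> qcarrier X"
  shows "T (f - g) = T f - T g"
proof -
  interpret X: quasi_normed_space X \<kappa> by fact
  interpret Y: quasi_normed_space Y \<kappa>' by fact
  show ?thesis
    using bounded_linear_on_add[OF T X.diff_in[OF f g] g] by simp
qed

lemma bounded_linear_on_closed_span:
  assumes X: "quasi_normed_space X \<kappa>" and Y: "quasi_normed_space Y \<kappa>'"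
    and T: "bounded_linear_on X (qcarrier X) Y T"
    and x: "\<And>n. n \<in> N \<Longrightarrow> x n \<in> qcarrier X"
    and Tx: "\<And>n. n \<in> N \<Longrightarrow> T (x n) \<in> y ` M"
    and f: "f \<in> closed_span X N x"
  shows "T f \<in> closed_span Y M y"
  unfolding closed_span_def
proof (intro CollectI conjI allI impI)
  interpret X: quasi_normed_space X \<kappa> by fact
  interpret Y: quasi_normed_space Y \<kappa>' by fact
  have fX: "f \<in> qcarrier X" using f by (simp add: closed_span_def)
  then show "T f \<in> qcarrier Y" using T by (rule bounded_linear_on_in[rotated])
  obtain C where C: "C \<ge> 0" "\<And>f. f \<in> qcarrier X \<Longrightarrow> qnorm Y (T f) \<le> C * qnorm X f"
    using bounded_linear_on_bound[OF T] by blast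
  fix \<epsilon> :: real assume "\<epsilon> > 0"
  define e where "e = \<epsilon> / (C + 1)"
  have e: "e > 0" "C * e < \<epsilon>" using \<open>\<epsilon> > 0\<close> C(1) by (auto simp: e_def field_simps)
  then obtain g where g: "g \<in> X.span (x ` N)" "qnorm X (f - g) < e"
    using f by (auto simp: closed_span_def)
  have Tg: "g \<in> qcarrier X" "T g \<in> Y.span (y ` M)"
    using bounded_linear_on_span[OF X Y T x _ g(1), of "y ` M"] Tx Y.span_base by blast+
  have "qnorm Y (T f - T g) = qnorm Y (T (f - g))"
    using bounded_linear_on_diff[OF X Y T fX Tg(1)] by simp
  also have "\<dots> \<le> C * qnorm X (f - g)" using C(2) X.diff_in[OF fX Tg(1)] by blast
  also have "\<dots> \<le> C * e" using g C(1) by (intro mult_left_mono) auto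
  finally have "qnorm Y (T f - T g) < \<epsilon>" using e(2) by simp
  then show "\<exists>g\<in>Y.span (y ` M). qnorm Y (T f - g) < \<epsilon>" using Tg(2) by blast
qed

text \<open>The difference of the two maps sends the family to the zero family, hence its closed
  span into the closed span of zero, which is trivial.\<close>

lemma bounded_linear_on_eqI:
  assumes X: "quasi_normed_space X \<kappa>" and Y: "quasi_normed_space Y \<kappa>'"
    and T: "bounded_linear_on X (qcarrier X) Y T" and U: "bounded_linear_on X (qcarrier X) Y U"
    and x: "\<And>n. n \<in> N \<Longrightarrow> x n \<in> qcarrier X"
    and eq: "\<And>n. n \<in> N \<Longrightarrow> T (x n) = U (x n)"
    and f: "f \<in> closed_span X N x"
  shows "T f = U f"
proof -
  interpret X: quasi_normed_space X \<kappa> by fact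
  interpret Y: quasi_normed_space Y \<kappa>' by fact
  define D where "D = (\<lambda>f. T f + - U f)"
  have D: "bounded_linear_on X (qcarrier X) Y D"
    unfolding D_def by (intro Y.bounded_linear_on_plus Y.bounded_linear_on_uminus T U)
  have "D f \<in> closed_span Y N (\<lambda>_. 0)"
    by (rule bounded_linear_on_closed_span[OF X Y D x _ f]) (auto simp: D_def eq)
  moreover have "Y.span ((\<lambda>_. 0) ` N) \<subseteq> {0}"
    by (rule Y.span_minimal) (auto intro: Y.subspace_single_0)
  ultimately have Df: "D f \<in> qcarrier Y" "\<And>\<epsilon>. \<epsilon> > 0 \<Longrightarrow> qnorm Y (D f) < \<epsilon>"
    by (fastforce simp: closed_span_def)+
  then have "qnorm Y (D f) = 0"
    using Y.norm_nonneg[OF Df(1)] by (metis less_irrefl order_le_less)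
  then show ?thesis using Y.norm_eq_0[OF Df(1)] by (simp add: D_def)
qed

text \<open>The coordinatewise inequalities survive the maximum with the same \<kappa>; positivity
  of \<open>s\<close> makes the maximum one over a nonempty set.\<close>

lemma quasi_normed_space_qpower:
  assumes X: "quasi_normed_space X \<kappa>" and s: "s \<ge> 1"
  shows "quasi_normed_space (qpower s X) \<kappa>"
proof -
  interpret X: quasi_normed_space X \<kappa> by fact
  interpret P: vector_space "qscale (qpower s X)"
    by unfold_locales
      (simp_all add: qpower_def fun_eq_iff X.scale_right_distrib X.scale_left_distrib)
  have ne: "{1..s} \<noteq> {}" using s by simp
  let ?n = "qnorm (qpower s X)"
  have n_def: "?n f = Max ((\<lambda>i. qnorm X (f i)) ` {1..s})" for f
    by (simp add: qpower_def)
  have n_ge: "qnorm X (f i) \<le> ?n f" if "i \<in> {1..s}" for f i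
    unfolding n_def using that by (intro Max_ge) auto
  have n_le: "?n f \<le> c" if "\<And>i. i \<in> {1..s} \<Longrightarrow> qnorm X (f i) \<le> c" for f c
    unfolding n_def using that ne by (intro Max.boundedI) auto
  have carrier: "f i \<in> qcarrier X" "i \<notin> {1..s} \<Longrightarrow> f i = 0" if "f \<in> qcarrier (qpower s X)" for f i
    using that X.zero_in by (auto simp: qpower_def)
  have n_nonneg: "0 \<le> ?n f" if f: "f \<in> qcarrier (qpower s X)" for f
    using X.norm_nonneg[OF carrier(1)[OF f, of 1]] n_ge[of 1 f] s by simp
  show ?thesis
  proof
    show "P.subspace (qcarrier (qpower s X))"
      by (rule P.subspaceI) (auto simp: qpower_def X.zero_in X.add_in X.scale_in)
    show "0 \<le> ?n f" if "f \<in> qcarrier (qpower s X)" for f using n_nonneg[OF that] .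
    show "?n f = 0 \<longleftrightarrow> f = 0" if f: "f \<in> qcarrier (qpower s X)" for f
    proof
      assume "?n f = 0"
      then have "f i = 0" if "i \<in> {1..s}" for i
        using n_ge[OF that, of f] X.norm_nonneg[OF carrier(1)[OF f, of i]] X.norm_eq_0[OF carrier(1)[OF f, of i]]
        by simp
      then show "f = 0" using carrier(2)[OF f] by (auto simp: fun_eq_iff)
    next
      assume "f = 0"
      then have "?n f \<le> 0" by (intro n_le) simp
      then show "?n f = 0" using n_nonneg[OF f] by simp
    qed
    show "?n (qscale (qpower s X) c f) = norm c * ?n f" if f: "f \<in> qcarrier (qpower s X)" for c f
    proof (rule antisym)
      have eq: "qnorm X (qscale (qpower s X) c f i) = norm c * qnorm X (f i)" for i
        using X.norm_scale[OF carrier(1)[OF f]] by (simp add: qpower_def)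
      show "?n (qscale (qpower s X) c f) \<le> norm c * ?n f"
        by (rule n_le) (simp add: eq n_ge mult_left_mono)
      have "?n f \<in> (\<lambda>i. qnorm X (f i)) ` {1..s}"
        unfolding n_def using ne by (intro Max_in) auto
      then obtain i where "i \<in> {1..s}" "?n f = qnorm X (f i)" by blast
      then show "norm c * ?n f \<le> ?n (qscale (qpower s X) c f)"
        using n_ge[of i "qscale (qpower s X) c f"] by (simp add: eq)
    qed
    show "?n (f + g) \<le> \<kappa> * (?n f + ?n g)"
      if f: "f \<in> qcarrier (qpower s X)" and g: "g \<in> qcarrier (qpower s X)" for f g
      by (rule n_le) (simp add: X.norm_triangle_le carrier(1)[OF f] carrier(1)[OF g] n_ge)
  qed (use X.kappa_ge_1 in auto)
qed

lemma bounded_linear_on_qpower_coordinate: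
  assumes "i \<in> {1..s}"
  shows "bounded_linear_on (qpower s X) (qcarrier (qpower s X)) X (\<lambda>f. f i)"
proof -
  have "qnorm X (f i) \<le> 1 * qnorm (qpower s X) f" for f
    using assms by (auto simp: qpower_def intro!: Max_ge)
  then have "\<exists>C\<ge>0. \<forall>f\<in>qcarrier (qpower s X). qnorm X (f i) \<le> C * qnorm (qpower s X) f"
    by (intro exI[of _ 1]) auto
  then show ?thesis using assms by (simp add: bounded_linear_on_def) (simp add: qpower_def)
qed

lemma bounded_linear_on_qpower:
  assumes X: "quasi_normed_space X \<kappa>" and Y: "quasi_normed_space Y \<kappa>'" and s: "s \<ge> 1"
    and T: "\<And>i. i \<in> {1..s} \<Longrightarrow> bounded_linear_on X (qcarrier X) Y (T i)"
  shows "bounded_linear_on X (qcarrier X) (qpower s Y) (\<lambda>f i. if i \<in> {1..s} then T i f else 0)"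
    (is "bounded_linear_on _ _ _ ?J")
proof -
  interpret X: quasi_normed_space X \<kappa> by fact
  interpret Y: quasi_normed_space Y \<kappa>' by fact
  have "\<exists>C. \<forall>i\<in>{1..s}. C i \<ge> 0 \<and> (\<forall>f\<in>qcarrier X. qnorm Y (T i f) \<le> C i * qnorm X f)"
    using T unfolding bounded_linear_on_def by (intro bchoice) blast
  then obtain C where C: "\<And>i. i \<in> {1..s} \<Longrightarrow> C i \<ge> 0"
      "\<And>i f. i \<in> {1..s} \<Longrightarrow> f \<in> qcarrier X \<Longrightarrow> qnorm Y (T i f) \<le> C i * qnorm X f"
    by blast
  have "qnorm (qpower s Y) (?J f) \<le> (\<Sum>i=1..s. C i) * qnorm X f" if f: "f \<in> qcarrier X" for f
  proof -
    have "qnorm Y (?J f i) \<le> (\<Sum>i=1..s. C i) * qnorm X f" if i: "i \<in> {1..s}" for i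
    proof -
      have "qnorm Y (?J f i) \<le> C i * qnorm X f" using C(2)[OF i f] i by simp
      also have "\<dots> \<le> (\<Sum>i=1..s. C i) * qnorm X f"
        using C(1) i X.norm_nonneg[OF f] by (intro mult_right_mono member_le_sum) auto
      finally show ?thesis .
    qed
    then show ?thesis using s unfolding qpower_def by (auto intro!: Max.boundedI)
  qed
  moreover have "(\<Sum>i=1..s. C i) \<ge> 0" using C(1) by (intro sum_nonneg) auto
  ultimately have "\<exists>C\<ge>0. \<forall>f\<in>qcarrier X. qnorm (qpower s Y) (?J f) \<le> C * qnorm X f" by blast
  moreover have "\<forall>f\<in>qcarrier X. ?J f \<in> qcarrier (qpower s Y)"
    using bounded_linear_on_in[OF T] by (auto simp: qpower_def)
  moreover have "\<forall>f\<in>qcarrier X. \<forall>g\<in>qcarrier X. ?J (f + g) = ?J f + ?J g"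
    using bounded_linear_on_add[OF T] by (auto simp: fun_eq_iff)
  moreover have "\<forall>c. \<forall>f\<in>qcarrier X. ?J (qscale X c f) = qscale (qpower s Y) c (?J f)"
    using bounded_linear_on_scale[OF T] by (auto simp: fun_eq_iff qpower_def)
  ultimately show ?thesis by (simp only: bounded_linear_on_def)
qed

section \<open>Projections onto subsets of an unconditional basis\<close>

context unconditional_basis_space
begin

text \<open>Completeness speaks of sequences, not nets, so finite sets \<open>B k\<close> with error
  below 1/(k+1) are selected and the sums over \<open>A \<inter> B k\<close> are shown to be Cauchy.
  Coefficients off \<open>A\<close> are set to 0 instead of shrinking the index set, which keeps the
  result an expansion over \<open>N\<close>.\<close>

lemma subseries_convergent:
  assumes f: "f \<in> qcarrier X" and K: "\<And>B. finite B \<Longrightarrow> B \<subseteq> N \<Longrightarrow> qnorm X (psum f B) \<le> c"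
  shows "\<exists>h\<in>qcarrier X. qnorm X h \<le> \<kappa> * c \<and>
           unconditionally_sums X N (\<lambda>n. qscale X (if n \<in> A then coef f n else 0) (x n)) h"
proof -
  have "\<exists>B\<^sub>0. finite B\<^sub>0 \<and> B\<^sub>0 \<subseteq> N \<and> (\<forall>B. finite B \<longrightarrow> B\<^sub>0 \<subseteq> B \<longrightarrow> B \<subseteq> N \<longrightarrow>
      qnorm X (psum f B - f) < inverse (real (Suc k)))" for k
    using psum_near[OF f, of "inverse (real (Suc k))"] by (metis inverse_positive_iff_positive of_nat_0_less_iff zero_less_Suc)
  then obtain B where B: "\<And>k. finite (B k)" "\<And>k. B k \<subseteq> N"
    and near: "\<And>k D. finite D \<Longrightarrow> B k \<subseteq> D \<Longrightarrow> D \<subseteq> N \<Longrightarrow> qnorm X (psum f D - f) < inverse (real (Suc k))"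
    by metis
  define F where "F = (\<lambda>k. psum f (A \<inter> B k))"
  have F: "F k \<in> qcarrier X" for k unfolding F_def using B(2) by (intro psum_in) blast
  \<comment> \<open>Twice the error 1/(k+1) times \<kappa>, the bound of
    \<open>psum_tail_small\<close>.\<close>
  define r where "r = (\<lambda>k. 2 * \<kappa> * inverse (real (Suc k)))"
  have near_F: "qnorm X (psum f (A \<inter> D) - F k) \<le> r k"
    if D: "finite D" "B k \<subseteq> D" "D \<subseteq> N" for D k
  proof -
    have "A \<inter> D = (A \<inter> B k) \<union> (A \<inter> (D - B k))" "(A \<inter> B k) \<inter> (A \<inter> (D - B k)) = {}"
      using D by blast+
    then have "psum f (A \<inter> D) - F k = psum f (A \<inter> (D - B k))"
      using psum_Un_disjoint[of "A \<inter> B k" "A \<inter> (D - B k)" f] B(1) D(1) by (auto simp: F_def)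
    moreover have "qnorm X (psum f (A \<inter> (D - B k))) \<le> \<kappa> * (inverse (real (Suc k)) + inverse (real (Suc k)))"
      by (rule psum_tail_small[OF f B(1)[of k] B(2)[of k] near]) (use D in auto)
    ultimately show ?thesis by (simp add: r_def)
  qed
  have r_lim: "r \<longlonglongrightarrow> 0"
    unfolding r_def using tendsto_mult_left[OF LIMSEQ_inverse_real_of_nat, of "2 * \<kappa>"] by simp
  have small: "\<exists>K. \<forall>k\<ge>K. r k < e" if "e > 0" for e
    using order_tendstoD(2)[OF r_lim that] by (simp add: eventually_sequentially)
  have "\<exists>K. \<forall>j\<ge>K. \<forall>k\<ge>K. qnorm X (F j - F k) < \<epsilon>" if "\<epsilon> > 0" for \<epsilon> :: real
  proof -
    define e where "e = \<epsilon> / (2 * \<kappa>)"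
    have e: "e > 0" "\<kappa> * (e + e) = \<epsilon>" using that kappa_ge_1 by (auto simp: e_def field_simps)
    obtain K where K: "\<And>k. k \<ge> K \<Longrightarrow> r k < e" using small[OF e(1)] by blast
    have "qnorm X (F j - F k) < \<epsilon>" if "j \<ge> K" "k \<ge> K" for j k
    proof -
      \<comment> \<open>The sets \<open>B k\<close> need not be nested; both sums are compared with
        the one over the union.\<close>
      let ?h = "psum f (A \<inter> (B j \<union> B k))"
      have h: "?h \<in> qcarrier X" using B(2) by (intro psum_in) blast
      have "qnorm X (?h - F j) \<le> r j" "qnorm X (?h - F k) \<le> r k"
        using B by (auto intro!: near_F)
      then have "qnorm X (F j - F k) \<le> \<kappa> * (r j + r k)"
        using norm_minus_commute[OF F h] by (intro norm_triangle_via[OF F F h]) simp_all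
      also have "\<dots> < \<kappa> * (e + e)"
        using K[OF that(1)] K[OF that(2)] kappa_ge_1 by (intro mult_strict_left_mono) auto
      finally show ?thesis using e(2) by simp
    qed
    then show ?thesis by blast
  qed
  then obtain h where h: "h \<in> qcarrier X" and lim: "(\<lambda>k. qnorm X (F k - h)) \<longlonglongrightarrow> 0"
    using complete[of F] F by blast
  have "qnorm X (F k) \<le> c" for k unfolding F_def using B by (intro K) auto
  then have "qnorm X h \<le> \<kappa> * c"
    using norm_limit_le[OF F h lim zero_in, of 0 c] by simp
  moreover have "unconditionally_sums X N (\<lambda>n. qscale X (if n \<in> A then coef f n else 0) (x n)) h"
  proof (subst unconditionally_sums_iff, safe)
    fix \<epsilon> :: real assume "\<epsilon> > 0"
    define e where "e = \<epsilon> / (2 * \<kappa>)"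
    have e: "e > 0" "\<kappa> * (e + e) = \<epsilon>" using \<open>\<epsilon> > 0\<close> kappa_ge_1 by (auto simp: e_def field_simps)
    have "\<forall>\<^sub>F k in sequentially. r k < e \<and> qnorm X (F k - h) < e"
      using order_tendstoD(2)[OF r_lim e(1)] order_tendstoD(2)[OF lim e(1)] by (rule eventually_conj)
    then obtain k where k: "r k < e" "qnorm X (F k - h) < e"
      by (auto simp: eventually_sequentially)
    have "qnorm X ((\<Sum>n\<in>D. qscale X (if n \<in> A then coef f n else 0) (x n)) - h) < \<epsilon>"
      if D: "finite D" "B k \<subseteq> D" "D \<subseteq> N" for D
    proof -
      have "(\<Sum>n\<in>D. qscale X (if n \<in> A then coef f n else 0) (x n)) =
          (\<Sum>n\<in>D. if n \<in> A then qscale X (coef f n) (x n) else 0)"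
        by (intro sum.cong) auto
      also have "\<dots> = psum f (A \<inter> D)"
        using D(1) by (simp add: psum_def sum.inter_restrict[symmetric] Int_commute)
      finally have eq: "(\<Sum>n\<in>D. qscale X (if n \<in> A then coef f n else 0) (x n)) = psum f (A \<inter> D)" .
      have "psum f (A \<inter> D) \<in> qcarrier X" using D by (intro psum_in) blast
      then have "qnorm X (psum f (A \<inter> D) - h) \<le> \<kappa> * (r k + qnorm X (F k - h))"
        using near_F[OF D] by (intro norm_triangle_via[OF _ h F]) auto
      also have "\<dots> < \<kappa> * (e + e)" using k kappa_ge_1 by (intro mult_strict_left_mono) auto
      finally show ?thesis using e(2) eq by simp
    qed
    then show "\<exists>B\<^sub>0. finite B\<^sub>0 \<and> B\<^sub>0 \<subseteq> N \<and> (\<forall>D. finite D \<longrightarrow> B\<^sub>0 \<subseteq> D \<longrightarrow> D \<subseteq> N \<longrightarrow>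
        qnorm X ((\<Sum>n\<in>D. qscale X (if n \<in> A then coef f n else 0) (x n)) - h) < \<epsilon>)"
      using B by (intro exI[of _ "B k"]) simp
  qed (use h scale_x_in in auto)
  ultimately show ?thesis using h by blast
qed

text \<open>The projection sends \<open>f\<close> to the limit of its subseries over
  \<open>A\<close>. Uniqueness of unconditional limits yields linearity, and the uniform bound on
  partial sums yields a norm bound.\<close>

lemma ex_basis_projection:
  "\<exists>P. bounded_linear_on X (qcarrier X) X P \<and> (\<forall>n\<in>N. P (x n) = (if n \<in> A then x n else 0))"
proof -
  obtain K where K: "K \<ge> 0"
      "\<And>f B. f \<in> qcarrier X \<Longrightarrow> finite B \<Longrightarrow> B \<subseteq> N \<Longrightarrow> qnorm X (psum f B) \<le> K * qnorm X f"
    using psum_uniformly_bounded by blast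
  let ?u = "\<lambda>f n. qscale X (if n \<in> A then coef f n else 0) (x n)"
  have u_in: "?u f n \<in> qcarrier X" if "n \<in> N" for f n using that scale_x_in by blast
  have "\<forall>f\<in>qcarrier X. \<exists>h. h \<in> qcarrier X \<and> qnorm X h \<le> \<kappa> * (K * qnorm X f) \<and>
      unconditionally_sums X N (?u f) h"
    using subseries_convergent[OF _ K(2)] by blast
  from bchoice[OF this] obtain P where P_all: "\<forall>f\<in>qcarrier X. P f \<in> qcarrier X \<and>
      qnorm X (P f) \<le> \<kappa> * (K * qnorm X f) \<and> unconditionally_sums X N (?u f) (P f)" ..
  have P: "P f \<in> qcarrier X" "qnorm X (P f) \<le> \<kappa> * (K * qnorm X f)"
      "unconditionally_sums X N (?u f) (P f)" if "f \<in> qcarrier X" for f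
    using P_all[rule_format, OF that] by simp_all
  have P_eqI: "P f = h"
    if "f \<in> qcarrier X" "h \<in> qcarrier X" "unconditionally_sums X N (?u f) h" for f h
    by (rule unconditionally_sums_unique[OF u_in P(1)[OF that(1)] that(2) P(3)[OF that(1)] that(3)])
  have "P (f + g) = P f + P g" if f: "f \<in> qcarrier X" and g: "g \<in> qcarrier X" for f g
  proof (rule P_eqI)
    have "?u f n + ?u g n = ?u (f + g) n" if "n \<in> N" for n
      using coef_add[OF f g that] by (simp add: scale_left_distrib)
    then show "unconditionally_sums X N (?u (f + g)) (P f + P g)"
      using unconditionally_sums_add[OF u_in P(1)[OF f] u_in P(1)[OF g] P(3)[OF f] P(3)[OF g]]
        unconditionally_sums_cong[of N "\<lambda>n. ?u f n + ?u g n" "?u (f + g)"] by blast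
  qed (use f g P(1) add_in in auto)
  moreover have "P (qscale X c f) = qscale X c (P f)" if f: "f \<in> qcarrier X" for c f
  proof (rule P_eqI)
    have "qscale X c (?u f n) = ?u (qscale X c f) n" if "n \<in> N" for n
      using coef_scale[OF f that] by simp
    then show "unconditionally_sums X N (?u (qscale X c f)) (qscale X c (P f))"
      using unconditionally_sums_scale[OF u_in P(1)[OF f] P(3)[OF f], of c]
        unconditionally_sums_cong[of N "\<lambda>n. qscale X c (?u f n)" "?u (qscale X c f)"] by blast
  qed (use f P(1) scale_in in auto)
  moreover have "\<kappa> * K \<ge> 0" using K(1) kappa_ge_1 by simp
  then have "\<exists>C\<ge>0. \<forall>f\<in>qcarrier X. qnorm X (P f) \<le> C * qnorm X f"
    using P(2) by (intro exI[of _ "\<kappa> * K"]) (simp add: mult.assoc)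
  ultimately have "bounded_linear_on X (qcarrier X) X P"
    using P(1) by (simp add: bounded_linear_on_def)
  moreover have "P (x m) = (if m \<in> A then x m else 0)" if m: "m \<in> N" for m
  proof (rule P_eqI)
    \<comment> \<open>In the expansion of \<open>x m\<close> only the coefficient at m is nonzero,
      so restricting to \<open>A\<close> amounts to multiplying the whole series by this
      scalar.\<close>
    let ?d = "if m \<in> A then 1 else 0"
    have "qscale X ?d (qscale X (coef (x m) n) (x n)) = ?u (x m) n" if "n \<in> N" for n
      using coef_x[OF m that] by auto
    moreover have "unconditionally_sums X N
        (\<lambda>n. qscale X ?d (qscale X (coef (x m) n) (x n))) (qscale X ?d (x m))"
      using m x_in scale_x_in coef_sums by (intro unconditionally_sums_scale) auto
    ultimately have "unconditionally_sums X N (?u (x m)) (qscale X ?d (x m))"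
      by (rule unconditionally_sums_cong[THEN iffD1])
    then show "unconditionally_sums X N (?u (x m)) (if m \<in> A then x m else 0)" by (simp split: if_splits)
  qed (use m x_in zero_in in auto)
  ultimately show ?thesis by blast
qed

end

section \<open>Assembling the permutative equivalence\<close>

lemma ex_quasi_banach_space:
  assumes "quasi_banach X"
  shows "\<exists>\<kappa>. quasi_banach_space X \<kappa>"
proof -
  obtain \<kappa> where "quasi_normed_space X \<kappa>"
    using assms unfolding quasi_banach_def quasi_normed_iff by blast
  then show ?thesis
    using assms unfolding quasi_banach_space_def quasi_banach_space_axioms_def quasi_banach_def by blast
qed

theorem theorem2p4:
  fixes X :: "('k::{real_normed_field,banach}, 'a::ab_group_add) qspace"
    and Y :: "('k, 'b::ab_group_add) qspace"
    and N :: "'i set" and M :: "'j set"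
    and x :: "'i \<Rightarrow> 'a" and y :: "'j \<Rightarrow> 'b"
    and s :: nat
  assumes "quasi_banach X" and "quasi_banach Y"
    and "unconditional_basis X N x" and "unconditional_basis Y M y"
    and "s \<ge> 2"
    and "permutatively_equivalent
           (qpower s X) ({1..s} \<times> N) (product_family x)
           (qpower s Y) ({1..s} \<times> M) (product_family y)"
  shows "permutatively_equivalent X N x Y M y"
proof -
  obtain \<kappa> where "quasi_banach_space X \<kappa>"
    using assms(1) ex_quasi_banach_space by blast
  then interpret X: unconditional_basis_space X \<kappa> N x
    using assms(3) by (simp add: unconditional_basis_space_def unconditional_basis_space_axioms_def)
  obtain \<kappa>' where "quasi_banach_space Y \<kappa>'"
    using assms(2) ex_quasi_banach_space by blast
  then interpret Y: unconditional_basis_space Y \<kappa>' M y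
    using assms(4) by (simp add: unconditional_basis_space_def unconditional_basis_space_axioms_def)
  have s: "s \<ge> 1" using assms(5) by simp
  note X_qn = X.quasi_normed_space_axioms and Y_qn = Y.quasi_normed_space_axioms
  note Xs_qn = quasi_normed_space_qpower[OF X_qn s] and Ys_qn = quasi_normed_space_qpower[OF Y_qn s]
  interpret Xs: quasi_normed_space "qpower s X" \<kappa> by (rule Xs_qn)
  let ?S = "closed_span (qpower s X) ({1..s} \<times> N) (product_family x)"
  obtain \<pi> T\<^sub>0 where \<pi>: "bij_betw \<pi> ({1..s} \<times> N) ({1..s} \<times> M)"
    and emb: "isomorphic_embedding (qpower s X) ?S (qpower s Y) T\<^sub>0"
    and T0: "\<And>p. p \<in> {1..s} \<times> N \<Longrightarrow> T\<^sub>0 (product_family x p) = product_family y (\<pi> p)"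
    using assms(6) unfolding permutatively_equivalent_def equivalent_families_def by blast
  have S_sub: "?S \<subseteq> qcarrier (qpower s X)" by (auto simp: closed_span_def)
  have bl_T0: "bounded_linear_on (qpower s X) ?S (qpower s Y) T\<^sub>0"
    using emb by (rule isomorphic_embedding_bounded_linear_on) (use S_sub Xs.norm_nonneg in blast)
  have "\<exists>\<sigma>. bij_betw \<sigma> N M \<and> (\<forall>n\<in>N. \<exists>i\<in>{1..s}. \<exists>j\<in>{1..s}. \<pi> (i, n) = (j, \<sigma> n))"
    using s \<pi> by (intro regular_bipartite_perfect_matching) auto
  then obtain \<sigma> where \<sigma>: "bij_betw \<sigma> N M"
    and "\<forall>n\<in>N. \<exists>p. fst p \<in> {1..s} \<and> snd p \<in> {1..s} \<and> \<pi> (fst p, n) = (snd p, \<sigma> n)"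
    by fastforce
  then obtain p where "\<forall>n\<in>N. fst (p n) \<in> {1..s} \<and> snd (p n) \<in> {1..s} \<and>
      \<pi> (fst (p n), n) = (snd (p n), \<sigma> n)"
    by metis
  then obtain i j where ij: "\<And>n. n \<in> N \<Longrightarrow> i n \<in> {1..s}" "\<And>n. n \<in> N \<Longrightarrow> j n \<in> {1..s}"
    "\<And>n. n \<in> N \<Longrightarrow> \<pi> (i n, n) = (j n, \<sigma> n)"
    using that[of "fst \<circ> p" "snd \<circ> p"] by simp
  have \<sigma>_in: "\<sigma> n \<in> M" if "n \<in> N" for n using \<sigma> that by (auto simp: bij_betw_def)
  have \<sigma>_inj: "\<sigma> m = \<sigma> n \<longleftrightarrow> m = n" if "m \<in> N" "n \<in> N" for m n
    using \<sigma> that by (auto simp: bij_betw_def inj_on_eq_iff)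

  have "\<forall>k. \<exists>P. bounded_linear_on X (qcarrier X) X P \<and>
      (\<forall>n\<in>N. P (x n) = (if n \<in> {n. i n = k} then x n else 0))"
    using X.ex_basis_projection by blast
  from choice[OF this] obtain P where P_all: "\<forall>k. bounded_linear_on X (qcarrier X) X (P k) \<and>
      (\<forall>n\<in>N. P k (x n) = (if n \<in> {n. i n = k} then x n else 0))" ..
  have P: "bounded_linear_on X (qcarrier X) X (P k)"
    "n \<in> N \<Longrightarrow> P k (x n) = (if i n = k then x n else 0)" for k n
    using P_all[rule_format, of k] by simp_all
  \<comment> \<open>The pieces of \<open>M\<close> are images under \<sigma>; by its injectivity
    \<open>y (\<sigma> n)\<close> survives in \<open>R k\<close> exactly when j(n) = k.\<close>
  have "\<forall>k. \<exists>P. bounded_linear_on Y (qcarrier Y) Y P \<and>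
      (\<forall>m\<in>M. P (y m) = (if m \<in> \<sigma> ` {n \<in> N. j n = k} then y m else 0))"
    using Y.ex_basis_projection by blast
  from choice[OF this] obtain R where R_all: "\<forall>k. bounded_linear_on Y (qcarrier Y) Y (R k) \<and>
      (\<forall>m\<in>M. R k (y m) = (if m \<in> \<sigma> ` {n \<in> N. j n = k} then y m else 0))" ..
  have R: "bounded_linear_on Y (qcarrier Y) Y (R k)"
    "m \<in> M \<Longrightarrow> R k (y m) = (if m \<in> \<sigma> ` {n \<in> N. j n = k} then y m else 0)" for k m
    using R_all[rule_format, of k] by simp_all
  have R_\<sigma>: "R k (y (\<sigma> n)) = (if j n = k then y (\<sigma> n) else 0)" if "n \<in> N" for k n
    using R(2)[OF \<sigma>_in[OF that], of k] \<sigma>_inj that by (auto simp: image_iff)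

  define J where "J = (\<lambda>f k. if k \<in> {1..s} then P k f else 0)"
  define J' where "J' = (\<lambda>f k. if k \<in> {1..s} then R k f else 0)"
  define Q :: "(nat \<Rightarrow> 'a) \<Rightarrow> 'a" where "Q = (\<lambda>g. \<Sum>k=1..s. g k)"
  define Q' :: "(nat \<Rightarrow> 'b) \<Rightarrow> 'b" where "Q' = (\<lambda>g. \<Sum>k=1..s. g k)"
  define T where "T = (\<lambda>f. Q' (T\<^sub>0 (J f)))"
  have bl_J: "bounded_linear_on X (qcarrier X) (qpower s X) J"
    unfolding J_def by (intro bounded_linear_on_qpower[OF X_qn X_qn s] P(1))
  have bl_J': "bounded_linear_on Y (qcarrier Y) (qpower s Y) J'"
    unfolding J'_def by (intro bounded_linear_on_qpower[OF Y_qn Y_qn s] R(1))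
  have bl_Q: "bounded_linear_on (qpower s X) (qcarrier (qpower s X)) X Q"
    unfolding Q_def
    by (intro X.bounded_linear_on_sum bounded_linear_on_qpower_coordinate) auto
  have bl_Q': "bounded_linear_on (qpower s Y) (qcarrier (qpower s Y)) Y Q'"
    unfolding Q'_def
    by (intro Y.bounded_linear_on_sum bounded_linear_on_qpower_coordinate) auto
  have J_x: "J (x n) = product_family x (i n, n)" if "n \<in> N" for n
    using ij(1)[OF that] P(2)[OF that] by (auto simp: J_def product_family_def fun_eq_iff)
  have J'_y: "J' (y (\<sigma> n)) = product_family y (j n, \<sigma> n)" if "n \<in> N" for n
    using ij(2)[OF that] R_\<sigma>[OF that] by (auto simp: J'_def product_family_def fun_eq_iff)
  have Q_x: "Q (product_family x (k, n)) = x n" if "k \<in> {1..s}" for k n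
    using that by (simp add: Q_def product_family_def sum.delta)
  have Q'_y: "Q' (product_family y (k, m)) = y m" if "k \<in> {1..s}" for k m
    using that by (simp add: Q'_def product_family_def sum.delta)
  \<comment> \<open>Membership in the power alone would not suffice, since \<open>T\<^sub>0\<close>
    is controlled only on this closed span.\<close>
  have J_in: "J f \<in> ?S" if "f \<in> qcarrier X" for f
  proof (rule bounded_linear_on_closed_span[OF X_qn Xs_qn bl_J X.x_in])
    show "J (x n) \<in> product_family x ` ({1..s} \<times> N)" if "n \<in> N" for n
      using J_x[OF that] ij(1)[OF that] that by blast
    show "f \<in> closed_span X N x" using that by (simp add: X.closed_span_eq)
  qed
  have bl_T0J: "bounded_linear_on X (qcarrier X) (qpower s Y) (\<lambda>f. T\<^sub>0 (J f))"
    using bl_J bl_T0 by (rule bounded_linear_on_comp) (use J_in in blast)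
  have bl_T: "bounded_linear_on X (qcarrier X) Y T"
    unfolding T_def using bl_T0J bl_Q'
    by (rule bounded_linear_on_comp) (use bounded_linear_on_in[OF bl_T0J] in blast)
  have T0J_x: "T\<^sub>0 (J (x n)) = product_family y (j n, \<sigma> n)" if "n \<in> N" for n
    using T0[of "(i n, n)"] J_x[OF that] ij[OF that] that by simp
  have T_x: "T (x n) = y (\<sigma> n)" if "n \<in> N" for n
    using T0J_x[OF that] Q'_y ij(2)[OF that] by (simp add: T_def)
  have "bounded_linear_on X (qcarrier X) X (\<lambda>f. Q (J f))"
    using bl_J bl_Q by (rule bounded_linear_on_comp) (use bounded_linear_on_in[OF bl_J] in blast)
  then have QJ: "Q (J f) = f" if "f \<in> qcarrier X" for f
    by (rule bounded_linear_on_eqI[OF X_qn X_qn _ bounded_linear_on_id X.x_in])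
      (use that J_x Q_x ij(1) X.closed_span_eq in auto)
  have "bounded_linear_on X (qcarrier X) (qpower s Y) (\<lambda>f. J' (T f))"
    using bl_T bl_J' by (rule bounded_linear_on_comp) (use bounded_linear_on_in[OF bl_T] in blast)
  \<comment> \<open>Summing coordinates could destroy norm, but on the range of
    \<open>T\<^sub>0\<close> after \<open>J\<close> it does not: spreading the sum out again by
    \<open>J'\<close> recovers the tuple. Both sides are bounded and agree at each
    \<open>x n\<close>.\<close>
  then have J'T: "J' (T f) = T\<^sub>0 (J f)" if "f \<in> qcarrier X" for f
    by (rule bounded_linear_on_eqI[OF X_qn Ys_qn _ bl_T0J X.x_in])
      (use that T_x J'_y T0J_x X.closed_span_eq in auto)
  obtain C\<^sub>1 where C1: "C\<^sub>1 \<ge> 0"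
      "\<And>g. g \<in> qcarrier (qpower s X) \<Longrightarrow> qnorm X (Q g) \<le> C\<^sub>1 * qnorm (qpower s X) g"
    using bounded_linear_on_bound[OF bl_Q] by blast
  obtain C\<^sub>2 where C2: "\<And>g. g \<in> ?S \<Longrightarrow> qnorm (qpower s X) g \<le> C\<^sub>2 * qnorm (qpower s Y) (T\<^sub>0 g)"
    using emb unfolding isomorphic_embedding_def by blast
  obtain C\<^sub>3 where C3: "C\<^sub>3 \<ge> 0"
      "\<And>g. g \<in> qcarrier Y \<Longrightarrow> qnorm (qpower s Y) (J' g) \<le> C\<^sub>3 * qnorm Y g"
    using bounded_linear_on_bound[OF bl_J'] by blast
  \<comment> \<open>The chain is f = Q(J f), then the lower estimate for \<open>T\<^sub>0\<close> at
    \<open>J f\<close>, then \<open>J'T\<close>, then boundedness of \<open>J'\<close>. As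
    \<open>C\<^sub>2\<close> comes without a sign, it is replaced by \<open>max C\<^sub>2 0\<close>
    before multiplying.\<close>
  have lower: "qnorm X f \<le> (C\<^sub>1 * (max C\<^sub>2 0 * C\<^sub>3)) * qnorm Y (T f)" if f: "f \<in> qcarrier X" for f
  proof -
    have Jf: "J f \<in> ?S" by (rule J_in[OF f])
    have Tf: "T f \<in> qcarrier Y" by (rule bounded_linear_on_in[OF bl_T f])
    have "0 \<le> qnorm (qpower s Y) (T\<^sub>0 (J f))"
      by (rule quasi_normed_space.norm_nonneg[OF Ys_qn bounded_linear_on_in[OF bl_T0J f]])
    then have "C\<^sub>2 * qnorm (qpower s Y) (T\<^sub>0 (J f)) \<le> max C\<^sub>2 0 * qnorm (qpower s Y) (T\<^sub>0 (J f))"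
      by (intro mult_right_mono) auto
    with C2[OF Jf] have J_le: "qnorm (qpower s X) (J f) \<le> max C\<^sub>2 0 * qnorm (qpower s Y) (T\<^sub>0 (J f))"
      by linarith
    have "qnorm X f \<le> C\<^sub>1 * qnorm (qpower s X) (J f)"
      using C1(2)[of "J f"] QJ[OF f] S_sub Jf by auto
    also have "\<dots> \<le> C\<^sub>1 * (max C\<^sub>2 0 * qnorm (qpower s Y) (J' (T f)))"
      using J_le J'T[OF f] C1(1) by (simp add: mult_left_mono)
    also have "\<dots> \<le> C\<^sub>1 * (max C\<^sub>2 0 * (C\<^sub>3 * qnorm Y (T f)))"
      using C3(2)[OF Tf] C1(1) by (intro mult_left_mono) auto
    finally show ?thesis by (simp add: mult_ac)
  qed
  have "isomorphic_embedding X (qcarrier X) Y T"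
    using bl_T lower unfolding isomorphic_embedding_def bounded_linear_on_def by blast
  then show ?thesis
    using \<sigma> T_x unfolding permutatively_equivalent_def equivalent_families_def X.closed_span_eq by blast
qed

end
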